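(* Let $X$ be a Banach space which satisfies the $LPR_p$ property for some $p$ with $2\le p<\infty$. Then $p(X)=2$.
   Context: Banach spaces are over $\mathbb C$. For an interval $I\subset\mathbb R$, $S_I$ is the partial sum operator defined by $(S_If)^{\wedge}=\hat f\chi_I$; for $1<p<\infty$ it is bounded on $L^p(\mathbb R)$ and is extended to $L^p(\mathbb R)\otimes X$ by $S_I(\sum_i\varphi_i x_i)=\sum_i (S_I\varphi_i)x_i$. Let $(r_j)$ denote (distinct) Rademacher functions on $[0,1]$. For $2\le p<\infty$, $X$ satisfies the $LPR_p$ property if there is a constant $C_{p,X}$ such that for every finite family $\{I_j\}_{j\in J}$ of disjoint intervals in $\mathbb R$, $$\Big\|\sum_{j\in J}r_jS_{I_j}f\Big\|_{L^p_{L^p_X([0,1])}(\mathbb R)}\le C_{p,X}\|f\|_{L^p_X(\mathbb R)}$$ (for all $f$ in the dense subspace $L^p(\mathbb R)\otimes X$ of $L^p_X(\mathbb R)$). Here $L^p_B$ denotes the Lebesgue-Bochner space of $B$-valued functions. $X$ is of Rademacher type $s$ ($1\le s\le 2$) if there is a constant $K$ such that $\int_0^1\|\sum_{i=1}^n r_i(t)x_i\|^s\,dt\le K\sum_{i=1}^n\|x_i\|^s$ for every finite family $x_1,\dots,x_n\in X$. Define $p(X)=\sup\{s: X\text{ has Rademacher type }s\}$. *)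

theory Defs
  imports "HOL-Analysis.Analysis"
begin

text \<open>Complex Banach spaces. The real structure of the class \<^class>\<open>banach\<close> is required to be the
  restriction of the complex one.\<close>

class complex_banach = banach +
  fixes scaleC :: "complex \<Rightarrow> 'a \<Rightarrow> 'a"  (infixr "*\<^sub>C" 75)
  assumes scaleC_add_right: "a *\<^sub>C (x + y) = a *\<^sub>C x + a *\<^sub>C y"
    and scaleC_add_left: "(a + b) *\<^sub>C x = a *\<^sub>C x + b *\<^sub>C x"
    and scaleC_scaleC: "a *\<^sub>C b *\<^sub>C x = (a * b) *\<^sub>C x"
    and scaleC_one: "1 *\<^sub>C x = x"
    and scaleR_scaleC: "r *\<^sub>R x = complex_of_real r *\<^sub>C x"
    and norm_scaleC: "norm (a *\<^sub>C x) = cmod a * norm x"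

instantiation complex :: complex_banach
begin

definition scaleC_complex_def: "scaleC (a :: complex) (x :: complex) = a * x"

instance
  by standard (auto simp: scaleC_complex_def algebra_simps norm_mult scaleR_conv_of_real)

end


text \<open>Functions rather than classes modulo null sets are used throughout. As the Bochner integral
  of a non-integrable function is 0, the value of \<open>Lp_norm\<close> is meaningful only for
  functions whose norm is p-integrable.\<close>

definition in_Lp :: "'b measure \<Rightarrow> real \<Rightarrow> ('b \<Rightarrow> complex) \<Rightarrow> bool" where
  "in_Lp M p f \<longleftrightarrow> f \<in> borel_measurable M \<and> integrable M (\<lambda>x. norm (f x) powr p)"

definition Lp_norm :: "'b measure \<Rightarrow> real \<Rightarrow> ('b \<Rightarrow> 'c::real_normed_vector) \<Rightarrow> real" where
  "Lp_norm M p f = (\<integral>x. norm (f x) powr p \<partial>M) powr (1 / p)"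

definition Lp_converges ::
    "'b measure \<Rightarrow> real \<Rightarrow> (nat \<Rightarrow> 'b \<Rightarrow> complex) \<Rightarrow> ('b \<Rightarrow> complex) \<Rightarrow> bool" where
  "Lp_converges M p u f \<longleftrightarrow> (\<forall>k. in_Lp M p (u k)) \<and> in_Lp M p f \<and>
     (\<lambda>k. Lp_norm M p (\<lambda>x. u k x - f x)) \<longlonglongrightarrow> 0"


definition fourier :: "(real \<Rightarrow> complex) \<Rightarrow> real \<Rightarrow> complex" where
  "fourier f \<xi> = (\<integral>x. f x * cis (- 2 * pi * x * \<xi>) \<partial>lborel)"

text \<open>\<open>has_fourier_L2 f g\<close>: the Fourier-Plancherel transform of the square integrable function \<open>f\<close>
  is \<open>g\<close> (almost everywhere), i.e. the extension by density of \<^const>\<open>fourier\<close> from the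
  functions that are both integrable and square integrable.\<close>

definition has_fourier_L2 :: "(real \<Rightarrow> complex) \<Rightarrow> (real \<Rightarrow> complex) \<Rightarrow> bool" where
  "has_fourier_L2 f g \<longleftrightarrow> (\<exists>u. (\<forall>k. integrable lborel (u k)) \<and>
     Lp_converges lborel 2 u f \<and> Lp_converges lborel 2 (\<lambda>k. fourier (u k)) g)"

text \<open>The graph of the partial sum operator for \<open>I\<close> on square integrable functions.\<close>

definition partial_sum_L2 :: "real set \<Rightarrow> (real \<Rightarrow> complex) \<Rightarrow> (real \<Rightarrow> complex) \<Rightarrow> bool" where
  "partial_sum_L2 I f g \<longleftrightarrow>
     (\<exists>h. has_fourier_L2 f h \<and> has_fourier_L2 g (\<lambda>\<xi>. h \<xi> * indicator I \<xi>))"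

text \<open>\<open>partial_sum p I f g\<close> says that \<open>g\<close> is (a representative of) the image of \<open>f\<close> under the
  partial sum operator for \<open>I\<close> on the Lebesgue space with exponent \<open>p\<close>. That operator is the
  bounded extension of the multiplier operator from the dense subspace of functions that are
  both square and p-integrable, so its graph is the closure of the graph of the latter. For an
  interval \<open>I\<close> and \<open>1 < p < \<infinity>\<close>, by the boundedness theorem of M. Riesz, every p-integrable
  \<open>f\<close> has such a \<open>g\<close>, unique up to null sets.\<close>

definition partial_sum ::
    "real \<Rightarrow> real set \<Rightarrow> (real \<Rightarrow> complex) \<Rightarrow> (real \<Rightarrow> complex) \<Rightarrow> bool" where
  "partial_sum p I f g \<longleftrightarrow> (\<exists>u v. (\<forall>k. partial_sum_L2 I (u k) (v k)) \<and>
     Lp_converges lborel p u f \<and> Lp_converges lborel p v g)"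


definition rademacher :: "nat \<Rightarrow> real \<Rightarrow> real" where
  "rademacher j t = (if even \<lfloor>2 ^ Suc j * t\<rfloor> then 1 else - 1)"

abbreviation unit_measure :: "real measure" where
  "unit_measure \<equiv> restrict_space lborel {0..1}"

text \<open>The tensor is \<open>f = (\<Sum>i<n. \<phi> i \<otimes> x i)\<close>, and \<open>\<psi> j i\<close> is the image of \<open>\<phi> i\<close> under the
  partial sum operator for \<open>I j\<close>. This determines \<open>\<psi> j i\<close> up to null sets, which do not
  affect the norms.\<close>

definition LPR :: "'a::complex_banach itself \<Rightarrow> real \<Rightarrow> bool" where
  "LPR X p \<longleftrightarrow> (\<exists>C. \<forall>(J :: nat set) (I :: nat \<Rightarrow> real set) (n :: nat) \<phi> (x :: nat \<Rightarrow> 'a) \<psi>.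
     finite J \<and> (\<forall>j\<in>J. is_interval (I j)) \<and> disjoint_family_on I J \<and>
     (\<forall>i<n. in_Lp lborel p (\<phi> i)) \<and>
     (\<forall>j\<in>J. \<forall>i<n. partial_sum p (I j) (\<phi> i) (\<psi> j i)) \<longrightarrow>
     Lp_norm lborel p (\<lambda>s. Lp_norm unit_measure p
         (\<lambda>t. \<Sum>j\<in>J. rademacher j t *\<^sub>R (\<Sum>i<n. \<psi> j i s *\<^sub>C x i)))
       \<le> C * Lp_norm lborel p (\<lambda>s. \<Sum>i<n. \<phi> i s *\<^sub>C x i))"


definition rademacher_type :: "'a::complex_banach itself \<Rightarrow> real \<Rightarrow> bool" where
  "rademacher_type X s \<longleftrightarrow> (\<exists>K. \<forall>(n :: nat) (x :: nat \<Rightarrow> 'a).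
     (\<integral>t. norm (\<Sum>i<n. rademacher i t *\<^sub>R x i) powr s \<partial>unit_measure)
       \<le> K * (\<Sum>i<n. norm (x i) powr s))"

definition type_index :: "'a::complex_banach itself \<Rightarrow> real" where
  "type_index X = Sup {s. 1 \<le> s \<and> s \<le> 2 \<and> rademacher_type X s}"

end

theory Submission
  imports Defs "HOL-Probability.Sinc_Integral"
begin

text \<open>
  The space has Rademacher type 2, by a direct argument avoiding the Maurey--Pisier theorem.
  Testing LPR on \<open>\<phi>(s) \<Sum>\<^sub>k e\<^bsup>2\<pi>iks\<^esup> z\<^sub>k\<close>, where the Fourier transform of \<open>\<phi>\<close> is supported in
  \<open>[-1/2, 1/2]\<close>, and removing the unimodular factors by the contraction principle gives
  \<open>E \<parallel>\<Sum> r\<^sub>k z\<^sub>k\<parallel>\<^sup>2 \<le> K sup\<^sub>s \<parallel>\<Sum>\<^sub>k e\<^bsup>2\<pi>iks\<^esup> z\<^sub>k\<parallel>\<^sup>2\<close>.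

  Take for the trigonometric polynomial a Fejer-type interpolation of \<open>N\<close> vectors \<open>y\<^sub>l\<close> of the unit ball
  at the \<open>N\<close>-th roots of unity, so that the supremum is at most 1, and let \<open>y\<^sub>l = \<epsilon>\<^sub>j x\<^sub>j / \<parallel>x\<^sub>j\<parallel>\<close> for \<open>l\<close> in a
  block of size about \<open>N \<parallel>x\<^sub>j\<parallel>\<^sup>2 / \<Sum>\<^sub>i \<parallel>x\<^sub>i\<parallel>\<^sup>2\<close>. Then \<open>\<Sum> r\<^sub>k z\<^sub>k = \<Sum> \<epsilon>\<^sub>j c\<^sub>j(r) x\<^sub>j / \<parallel>x\<^sub>j\<parallel>\<close>, where by Parseval
  and the Khintchine inequality \<open>E \<bar>c\<^sub>j\<bar>\<close> dominates \<open>\<parallel>x\<^sub>j\<parallel> / (\<Sum>\<^sub>i \<parallel>x\<^sub>i\<parallel>\<^sup>2)\<^bsup>1/2\<^esup>\<close>.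
  Averaging over \<open>\<epsilon>\<close>, replacing \<open>c\<^sub>j\<close> by \<open>\<bar>c\<^sub>j\<bar>\<close> and applying Jensen's inequality in \<open>r\<close> yields type 2.
\<close>

section \<open>Averages over signs\<close>

text \<open>Coordinates from \<open>n\<close> onwards are set to 0, so that \<open>\<bar>e i\<bar> \<le> 1\<close> holds for all \<open>i\<close>.\<close>

primrec sign_avg :: "nat \<Rightarrow> ((nat \<Rightarrow> real) \<Rightarrow> 'v::real_vector) \<Rightarrow> 'v" where
  "sign_avg 0 F = F (\<lambda>_. 0)"
| "sign_avg (Suc n) F = (1/2) *\<^sub>R
     (sign_avg n (\<lambda>e. F (case_nat 1 e)) + sign_avg n (\<lambda>e. F (case_nat (-1) e)))"

lemma sign_avg_linear: "linear f \<Longrightarrow> sign_avg n (\<lambda>e. f (F e)) = f (sign_avg n F)"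
  by (induction n arbitrary: F) (simp_all add: linear_add linear_scale)

lemma sign_avg_const [simp]: "sign_avg n (\<lambda>e. c) = c"
  by (induction n) (simp_all flip: scaleR_left_distrib)

lemma sign_avg_add: "sign_avg n (\<lambda>e. F e + G e) = sign_avg n F + sign_avg n G"
  by (induction n arbitrary: F G) (simp_all add: algebra_simps)

lemma sign_avg_scaleR: "sign_avg n (\<lambda>e. c *\<^sub>R F e) = c *\<^sub>R sign_avg n F"
  by (induction n arbitrary: F) (simp_all add: algebra_simps)

lemma sign_avg_mult: "sign_avg n (\<lambda>e. c * F e) = c * (sign_avg n F :: real)"
  using sign_avg_scaleR[of n c F] by simp

lemma sign_avg_sum: "sign_avg n (\<lambda>e. \<Sum>j\<in>A. F j e) = (\<Sum>j\<in>A. sign_avg n (F j))"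
  by (induction A rule: infinite_finite_induct) (simp_all add: sign_avg_add)

lemma sign_avg_mono: "(\<And>e. F e \<le> (G e :: real)) \<Longrightarrow> sign_avg n F \<le> sign_avg n G"
  by (induction n arbitrary: F G) (simp_all add: add_mono)

text \<open>Only sign vectors padded with 0 are ever evaluated, so a pointwise bound on the cube
  suffices. The Fejer estimate, which requires test vectors in the unit ball, enters the averaging
  over signs in this form.\<close>

lemma sign_avg_mono_bounded:
  "(\<And>e. (\<And>i. \<bar>e i\<bar> \<le> 1) \<Longrightarrow> F e \<le> (G e :: real)) \<Longrightarrow> sign_avg n F \<le> sign_avg n G"
proof (induction n arbitrary: F G)
  case (Suc n)
  have "sign_avg n (\<lambda>e. F (case_nat b e)) \<le> sign_avg n (\<lambda>e. G (case_nat b e))" if "\<bar>b\<bar> \<le> 1" for b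
    using that by (intro Suc) (auto split: nat.split)
  from this[of 1] this[of "-1"] show ?case by simp
qed simp

lemma sign_avg_nonneg: "(\<And>e. 0 \<le> (F e :: real)) \<Longrightarrow> 0 \<le> sign_avg n F"
  using sign_avg_mono[of "\<lambda>_. 0" F n] by simp

lemma sign_avg_swap:
  "sign_avg n (\<lambda>e. sign_avg m (\<lambda>d. F e d)) = sign_avg m (\<lambda>d. sign_avg n (\<lambda>e. F e d))"
  by (induction n arbitrary: F) (simp_all add: sign_avg_add sign_avg_scaleR flip: scaleR_add_right)

lemma sign_avg_integrable:
  fixes F :: "(nat \<Rightarrow> real) \<Rightarrow> 'b \<Rightarrow> real"
  shows "(\<And>e. integrable M (F e)) \<Longrightarrow> integrable M (\<lambda>s. sign_avg n (\<lambda>e. F e s))"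
  by (induction n arbitrary: F) auto

section \<open>Jensen's inequality for sign averages, by repeated midpoint convexity\<close>

lemma norm_midpoint_square:
  "(norm ((1/2) *\<^sub>R (x + y)))\<^sup>2 \<le> ((norm x)\<^sup>2 + (norm (y::'a::real_normed_vector))\<^sup>2) / 2"
proof -
  have "(norm ((1/2) *\<^sub>R (x + y)))\<^sup>2 \<le> ((norm x + norm y) / 2)\<^sup>2"
    using norm_triangle_ineq[of x y] by (intro power_mono) auto
  also have "\<dots> \<le> ((norm x)\<^sup>2 + (norm y)\<^sup>2) / 2"
    using sum_squares_bound[of "norm x" "norm y"] by (simp add: power2_sum power_divide field_simps)
  finally show ?thesis .
qed

lemma norm_sign_avg_square_le:
  fixes F :: "(nat \<Rightarrow> real) \<Rightarrow> 'a::real_normed_vector"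
  shows "(norm (sign_avg n F))\<^sup>2 \<le> sign_avg n (\<lambda>e. (norm (F e))\<^sup>2)"
proof (induction n arbitrary: F)
  case (Suc n)
  show ?case
    using norm_midpoint_square[of "sign_avg n (\<lambda>e. F (case_nat 1 e))" "sign_avg n (\<lambda>e. F (case_nat (-1) e))"]
      Suc[of "\<lambda>e. F (case_nat 1 e)"] Suc[of "\<lambda>e. F (case_nat (-1) e)"]
    by simp
qed simp

lemma powr_midpoint_le:
  fixes a b :: real
  assumes "0 \<le> a" "0 \<le> b" "1 \<le> q"
  shows "((a + b) / 2) powr q \<le> (a powr q + b powr q) / 2"
proof (cases "a = 0 \<or> b = 0")
  case True
  \<comment> \<open>Convexity is invoked on the open half-line below, so a vanishing endpoint is
    handled directly, through (1/2)^q \<le> 1/2.\<close>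
  have "(1/2::real) powr q \<le> (1/2) powr 1"
    using assms by (intro powr_mono') auto
  then have "(1/2) powr q * c powr q \<le> c powr q / 2" for c :: real
    using mult_right_mono[of "(1/2) powr q" "1/2" "c powr q"] by simp
  moreover have "(c/2) powr q = (1/2) powr q * c powr q" if "0 \<le> c" for c :: real
    using that by (subst powr_mult[symmetric]) auto
  ultimately have half: "(c/2) powr q \<le> c powr q / 2" if "0 \<le> c" for c :: real
    using that by metis
  show ?thesis using True half[OF assms(1)] half[OF assms(2)] assms(3) by auto
next
  case False
  have "convex_on {0<..} (\<lambda>x::real. x powr q)"
    using assms(3) by (intro powr_convex)
  from convex_onD[OF this, of "1/2" a b] show ?thesis
    using False assms by (simp add: add_divide_distrib)
qed

lemma powr_sign_avg_le:
  fixes F :: "(nat \<Rightarrow> real) \<Rightarrow> real"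
  assumes "1 \<le> q"
  shows "(\<And>e. 0 \<le> F e) \<Longrightarrow> sign_avg n F powr q \<le> sign_avg n (\<lambda>e. F e powr q)"
proof (induction n arbitrary: F)
  case (Suc n)
  show ?case
    using powr_midpoint_le[of "sign_avg n (\<lambda>e. F (case_nat 1 e))" "sign_avg n (\<lambda>e. F (case_nat (-1) e))" q]
      Suc(1)[of "\<lambda>e. F (case_nat 1 e)"] Suc(1)[of "\<lambda>e. F (case_nat (-1) e)"] Suc(2) assms
    by (simp add: sign_avg_nonneg)
qed simp

section \<open>The contraction principle\<close>

lemma sum_case_nat:
  "(\<Sum>i<Suc n. case_nat a e i *\<^sub>R x i) = a *\<^sub>R x 0 + (\<Sum>i<n. e i *\<^sub>R (x (Suc i) :: 'a::real_vector))"
  by (subst sum.lessThan_Suc_shift) simp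

text \<open>As a function of \<open>a\<close>, the left-hand side is even and convex, so on [-1, 1]
  it is largest at the endpoints. Concretely, \<open>w + b *\<^sub>R x\<close> is the convex
  combination of \<open>w + x\<close> and \<open>w - x\<close> with weights (1+b)/2 and
  (1-b)/2.\<close>

lemma even_convex_scaled_le:
  fixes x w :: "'a::real_normed_vector"
  assumes "\<bar>a\<bar> \<le> 1"
  shows "(norm (w + a *\<^sub>R x))\<^sup>2 + (norm (w - a *\<^sub>R x))\<^sup>2 \<le> (norm (w + x))\<^sup>2 + (norm (w - x))\<^sup>2"
proof -
  have conv: "(norm (((1+b)/2) *\<^sub>R u + ((1-b)/2) *\<^sub>R v))\<^sup>2 \<le> ((1+b)/2) * (norm u)\<^sup>2 + ((1-b)/2) * (norm v)\<^sup>2"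
    if "\<bar>b\<bar> \<le> 1" for b and u v :: 'a
  proof -
    have "norm (((1+b)/2) *\<^sub>R u + ((1-b)/2) *\<^sub>R v) \<le> ((1+b)/2) * norm u + ((1-b)/2) * norm v"
      using that by (intro order_trans[OF norm_triangle_ineq]) auto
    then have "(norm (((1+b)/2) *\<^sub>R u + ((1-b)/2) *\<^sub>R v))\<^sup>2 \<le> (((1+b)/2) * norm u + ((1-b)/2) * norm v)\<^sup>2"
      by (intro power_mono) auto
    \<comment> \<open>The square of a weighted mean is the mean of the squares minus a variance,
      which is nonnegative because b^2 \<le> 1.\<close>
    also have "\<dots> = ((1+b)/2) * (norm u)\<^sup>2 + ((1-b)/2) * (norm v)\<^sup>2 - (1 - b\<^sup>2) / 4 * (norm u - norm v)\<^sup>2"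
      by (simp add: power2_eq_square field_simps)
    also have "\<dots> \<le> ((1+b)/2) * (norm u)\<^sup>2 + ((1-b)/2) * (norm v)\<^sup>2"
      using that by (simp add: abs_square_le_1)
    finally show ?thesis .
  qed
  have e: "((1+b)/2) *\<^sub>R (w + x) + ((1-b)/2) *\<^sub>R (w - x) = w + b *\<^sub>R x" for b
  proof -
    have "((1+b)/2) *\<^sub>R (w + x) + ((1-b)/2) *\<^sub>R (w - x) = ((1+b)/2 + (1-b)/2) *\<^sub>R w + ((1+b)/2 - (1-b)/2) *\<^sub>R x"
      by (simp only: scaleR_add_right scaleR_diff_right scaleR_add_left scaleR_diff_left) simp
    moreover have "(1+b)/2 + (1-b)/2 = 1" "(1+b)/2 - (1-b)/2 = b" by (auto simp: field_simps)
    ultimately show ?thesis by simp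
  qed
  have "(norm (w + b *\<^sub>R x))\<^sup>2 \<le> ((1+b)/2) * (norm (w + x))\<^sup>2 + ((1-b)/2) * (norm (w - x))\<^sup>2"
    if "\<bar>b\<bar> \<le> 1" for b
    using conv[OF that, of "w + x" "w - x"] unfolding e .
  from this[of a] this[of "-a"] show ?thesis
    using assms by (simp add: field_simps)
qed

text \<open>The shift \<open>w\<close> makes the induction work: it absorbs the first term once its
  sign is fixed, and averaging over that sign is exactly the situation of
  \<open>even_convex_scaled_le\<close>.\<close>

lemma contraction_shifted:
  fixes x :: "nat \<Rightarrow> 'a::real_normed_vector"
  assumes "\<And>i. \<bar>a i\<bar> \<le> 1"
  shows "sign_avg n (\<lambda>e. (norm (w + (\<Sum>i<n. e i *\<^sub>R a i *\<^sub>R x i)))\<^sup>2)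
    \<le> sign_avg n (\<lambda>e. (norm (w + (\<Sum>i<n. e i *\<^sub>R x i)))\<^sup>2)"
  using assms
proof (induction n arbitrary: w x a)
  case (Suc n)
  let ?T = "\<lambda>e. \<Sum>i<n. e i *\<^sub>R x (Suc i)"
  have IH: "sign_avg n (\<lambda>e. (norm (v + (\<Sum>i<n. e i *\<^sub>R a (Suc i) *\<^sub>R x (Suc i))))\<^sup>2)
      \<le> sign_avg n (\<lambda>e. (norm (v + ?T e))\<^sup>2)" for v
    using Suc(1)[of "\<lambda>i. a (Suc i)" v "\<lambda>i. x (Suc i)"] Suc(2) by simp
  have "sign_avg n (\<lambda>e. (norm (w + a 0 *\<^sub>R x 0 + ?T e))\<^sup>2) + sign_avg n (\<lambda>e. (norm (w - a 0 *\<^sub>R x 0 + ?T e))\<^sup>2)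
     \<le> sign_avg n (\<lambda>e. (norm (w + x 0 + ?T e))\<^sup>2) + sign_avg n (\<lambda>e. (norm (w - x 0 + ?T e))\<^sup>2)"
    unfolding sign_avg_add[symmetric]
    using even_convex_scaled_le[OF Suc(2)[of 0], of "w + ?T e" "x 0" for e]
    by (intro sign_avg_mono) (simp add: algebra_simps)
  then show ?case
    using IH[of "w + a 0 *\<^sub>R x 0"] IH[of "w - a 0 *\<^sub>R x 0"]
    unfolding sign_avg.simps sum_case_nat
    by (simp add: add.assoc diff_conv_add_uminus del: add_uminus_conv_diff)
qed simp

lemma contraction_real:
  fixes x :: "nat \<Rightarrow> 'a::real_normed_vector"
  assumes "\<And>i. \<bar>a i\<bar> \<le> 1"
  shows "sign_avg n (\<lambda>e. (norm (\<Sum>i<n. e i *\<^sub>R a i *\<^sub>R x i))\<^sup>2)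
    \<le> sign_avg n (\<lambda>e. (norm (\<Sum>i<n. e i *\<^sub>R x i))\<^sup>2)"
  using contraction_shifted[of a n 0 x] assms by simp

lemma norm_add_square_le: "(norm (x + y))\<^sup>2 \<le> 2 * (norm x)\<^sup>2 + 2 * (norm (y::'a::real_normed_vector))\<^sup>2"
  using norm_midpoint_square[of x y] by (simp add: power_mult_distrib power_divide)

lemma linear_scaleC: "linear (\<lambda>x. c *\<^sub>C (x::'a::complex_banach))"
  by (intro linearI) (simp_all add: scaleC_add_right scaleR_scaleC scaleC_scaleC mult.commute)

text \<open>Splitting the coefficients into real and imaginary parts gives two real contractions.
  Each is weighted by 2 from \<open>norm_add_square_le\<close>, hence the factor 4.\<close>

lemma contraction_complex:
  fixes x :: "nat \<Rightarrow> 'a::complex_banach"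
  assumes "\<And>i. cmod (c i) \<le> 1"
  shows "sign_avg n (\<lambda>e. (norm (\<Sum>i<n. e i *\<^sub>R c i *\<^sub>C x i))\<^sup>2)
    \<le> 4 * sign_avg n (\<lambda>e. (norm (\<Sum>i<n. e i *\<^sub>R x i))\<^sup>2)"
proof -
  have split: "c i *\<^sub>C x i = Re (c i) *\<^sub>R x i + \<i> *\<^sub>C (Im (c i) *\<^sub>R x i)" for i
    by (simp add: scaleR_scaleC scaleC_scaleC flip: scaleC_add_left complex_eq)
  have eq: "(\<Sum>i<n. e i *\<^sub>R c i *\<^sub>C x i)
     = (\<Sum>i<n. e i *\<^sub>R Re (c i) *\<^sub>R x i) + \<i> *\<^sub>C (\<Sum>i<n. e i *\<^sub>R Im (c i) *\<^sub>R x i)" for e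
    by (simp only: split linear_sum[OF linear_scaleC] linear_scale[OF linear_scaleC] scaleR_add_right sum.distrib)
  have "sign_avg n (\<lambda>e. (norm (\<Sum>i<n. e i *\<^sub>R c i *\<^sub>C x i))\<^sup>2)
    \<le> sign_avg n (\<lambda>e. 2 * (norm (\<Sum>i<n. e i *\<^sub>R Re (c i) *\<^sub>R x i))\<^sup>2 + 2 * (norm (\<Sum>i<n. e i *\<^sub>R Im (c i) *\<^sub>R x i))\<^sup>2)"
    unfolding eq by (intro sign_avg_mono order_trans[OF norm_add_square_le]) (simp add: norm_scaleC)
  also have "\<dots> \<le> 4 * sign_avg n (\<lambda>e. (norm (\<Sum>i<n. e i *\<^sub>R x i))\<^sup>2)"
    unfolding sign_avg_add sign_avg_mult
    using contraction_real[of "\<lambda>i. Re (c i)" n x] contraction_real[of "\<lambda>i. Im (c i)" n x]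
      abs_Re_le_cmod[of "c i" for i] abs_Im_le_cmod[of "c i" for i] order_trans[OF _ assms]
    by (smt (verit))
  finally show ?thesis .
qed

text \<open>Multiplying by the conjugate phase of \<open>c j\<close> turns \<open>c j\<close> into
  its modulus, and conjugate phases are admissible coefficients for the contraction
  principle.\<close>

lemma contraction_modulus:
  fixes u :: "nat \<Rightarrow> 'a::complex_banach"
  shows "sign_avg n (\<lambda>e. (norm (\<Sum>j<n. e j *\<^sub>R cmod (c j) *\<^sub>R u j))\<^sup>2)
    \<le> 4 * sign_avg n (\<lambda>e. (norm (\<Sum>j<n. e j *\<^sub>R c j *\<^sub>C u j))\<^sup>2)"
proof -
  have "cmod (c j) *\<^sub>R u j = cnj (sgn (c j)) *\<^sub>C c j *\<^sub>C u j" for j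
  proof -
    have "cnj (sgn (c j)) * c j = of_real (cmod (c j))"
      by (cases "c j = 0")
        (simp_all add: sgn_div_norm scaleR_conv_of_real mult.assoc mult.commute[of "cnj _"] power2_eq_square
          flip: complex_norm_square)
    then show ?thesis by (simp add: scaleR_scaleC scaleC_scaleC)
  qed
  then show ?thesis
    using contraction_complex[of "\<lambda>j. cnj (sgn (c j))" n "\<lambda>j. c j *\<^sub>C u j"] by (simp add: norm_sgn)
qed

section \<open>The Khintchine inequality\<close>

text \<open>Averaging over the first sign cancels the odd powers of \<open>a 0\<close>, which leaves
  recursions for the second and fourth moments.\<close>

lemma sign_avg_square_fourth:
  fixes a :: "nat \<Rightarrow> real"
  shows "sign_avg n (\<lambda>e. (\<Sum>i<n. e i * a i)\<^sup>2) = (\<Sum>i<n. (a i)\<^sup>2) \<and>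
    sign_avg n (\<lambda>e. (\<Sum>i<n. e i * a i)^4) \<le> 3 * (\<Sum>i<n. (a i)\<^sup>2)\<^sup>2"
proof (induction n arbitrary: a)
  case (Suc n)
  let ?T = "\<lambda>e. \<Sum>i<n. e i * a (Suc i)" and ?s = "\<Sum>i<n. (a (Suc i))\<^sup>2"
  have T: "(\<Sum>i<Suc n. case_nat b e i * a i) = b * a 0 + ?T e" for b e
    by (subst sum.lessThan_Suc_shift) simp
  have s: "(\<Sum>i<Suc n. (a i)\<^sup>2) = (a 0)\<^sup>2 + ?s"
    by (subst sum.lessThan_Suc_shift) simp
  have IH: "sign_avg n (\<lambda>e. (?T e)\<^sup>2) = ?s" "sign_avg n (\<lambda>e. (?T e)^4) \<le> 3 * ?s\<^sup>2"
    using Suc[of "\<lambda>i. a (Suc i)"] by auto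
  have "sign_avg (Suc n) (\<lambda>e. (\<Sum>i<Suc n. e i * a i)\<^sup>2)
      = sign_avg n (\<lambda>e. (1/2) * ((a 0 + ?T e)\<^sup>2 + (- a 0 + ?T e)\<^sup>2))"
    by (subst sign_avg_mult, subst sign_avg_add) (simp add: T del: sum.lessThan_Suc)
  also have "\<dots> = sign_avg n (\<lambda>e. (a 0)\<^sup>2 + (?T e)\<^sup>2)"
    by (intro arg_cong[where f = "sign_avg n"] ext) (simp add: power2_eq_square algebra_simps)
  finally have 1: "sign_avg (Suc n) (\<lambda>e. (\<Sum>i<Suc n. e i * a i)\<^sup>2) = (a 0)\<^sup>2 + ?s"
    by (simp add: sign_avg_add IH)
  have "sign_avg (Suc n) (\<lambda>e. (\<Sum>i<Suc n. e i * a i)^4)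
      = sign_avg n (\<lambda>e. (1/2) * ((a 0 + ?T e)^4 + (- a 0 + ?T e)^4))"
    by (subst sign_avg_mult, subst sign_avg_add) (simp add: T del: sum.lessThan_Suc)
  also have "\<dots> = sign_avg n (\<lambda>e. (a 0)^4 + (6 * (a 0)\<^sup>2 * (?T e)\<^sup>2 + (?T e)^4))"
    by (intro arg_cong[where f = "sign_avg n"] ext) (simp add: power4_eq_xxxx power2_eq_square algebra_simps)
  also have "\<dots> = (a 0)^4 + (6 * (a 0)\<^sup>2 * ?s + sign_avg n (\<lambda>e. (?T e)^4))"
    by (simp add: sign_avg_add sign_avg_mult IH)
  \<comment> \<open>Enlarging the first coefficient from 1 to 3 completes the square.\<close>
  also have "\<dots> \<le> 3 * (a 0)^4 + (6 * (a 0)\<^sup>2 * ?s + 3 * ?s\<^sup>2)"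
  proof -
    have "0 \<le> (a 0)^4" by simp
    then show ?thesis using IH(2) by linarith
  qed
  also have "\<dots> = 3 * ((a 0)\<^sup>2 + ?s)\<^sup>2"
    by (simp add: power2_sum power_mult_distrib algebra_simps)
  finally show ?case using 1 unfolding s by simp
qed simp

lemma khintchine_real:
  fixes a :: "nat \<Rightarrow> real"
  shows "5/9 * sqrt (\<Sum>i<n. (a i)\<^sup>2) \<le> sign_avg n (\<lambda>e. \<bar>\<Sum>i<n. e i * a i\<bar>)"
proof (cases "(\<Sum>i<n. (a i)\<^sup>2) = 0")
  case True
  then show ?thesis by (simp add: sign_avg_nonneg)
next
  case False
  define \<sigma> where "\<sigma> = sqrt (\<Sum>i<n. (a i)\<^sup>2)"
  have \<sigma>: "0 < \<sigma>" "(\<Sum>i<n. (a i)\<^sup>2) = \<sigma>\<^sup>2"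
    using False by (simp_all add: \<sigma>_def sum_nonneg order_less_le)
  \<comment> \<open>\<open>t \<ge> t\<^sup>2 - (4/27) t\<^sup>4\<close> at \<open>t = \<bar>x\<bar> / \<sigma>\<close>, with contact at \<open>t = 3/2\<close>\<close>
  have pt: "\<sigma>\<^sup>2 * x\<^sup>2 + (- 4/27) * x^4 \<le> \<sigma>^3 * \<bar>x\<bar>" for x
  proof -
    define y where "y = \<bar>x\<bar>"
    \<comment> \<open>The product expands to 4 y^4 - 27 \<sigma>^2 y^2 + 27 \<sigma>^3 y, which is
      27 times the required difference.\<close>
    have "0 \<le> y * ((y + 3 * \<sigma>) * (2 * y - 3 * \<sigma>)\<^sup>2)"
      using \<sigma> by (intro mult_nonneg_nonneg) (auto simp: y_def)
    then have "\<sigma>\<^sup>2 * y\<^sup>2 + (- 4/27) * y^4 \<le> \<sigma>^3 * y"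
      by (simp add: power4_eq_xxxx power2_eq_square power3_eq_cube algebra_simps)
    then show ?thesis by (simp add: y_def)
  qed
  \<comment> \<open>The two moments turn the pointwise bound into the constant 1 - 3 * 4/27 =
    5/9.\<close>
  have "\<sigma>^3 * (5/9 * \<sigma>) = \<sigma>\<^sup>2 * \<sigma>\<^sup>2 + (-4/27) * (3 * (\<sigma>\<^sup>2)\<^sup>2)"
    by (simp add: power2_eq_square power3_eq_cube)
  also have "\<dots> \<le> sign_avg n (\<lambda>e. \<sigma>\<^sup>2 * (\<Sum>i<n. e i * a i)\<^sup>2 + (-4/27) * (\<Sum>i<n. e i * a i)^4)"
    using sign_avg_square_fourth[of n a] unfolding sign_avg_add sign_avg_mult \<sigma> by simp
  also have "\<dots> \<le> \<sigma>^3 * sign_avg n (\<lambda>e. \<bar>\<Sum>i<n. e i * a i\<bar>)"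
    unfolding sign_avg_mult[symmetric] by (intro sign_avg_mono pt)
  finally show ?thesis using \<sigma>(1) unfolding \<sigma>_def[symmetric] by simp
qed

lemma khintchine_complex:
  fixes a :: "nat \<Rightarrow> complex"
  shows "1/3 * sqrt (\<Sum>i<n. (cmod (a i))\<^sup>2) \<le> sign_avg n (\<lambda>e. cmod (\<Sum>i<n. e i *\<^sub>R a i))"
proof -
  let ?s = "\<Sum>i<n. (cmod (a i))\<^sup>2" and ?R = "\<Sum>i<n. (Re (a i))\<^sup>2" and ?I = "\<Sum>i<n. (Im (a i))\<^sup>2"
  let ?m = "sign_avg n (\<lambda>e. cmod (\<Sum>i<n. e i *\<^sub>R a i))"
  have s: "?s = ?R + ?I" by (simp add: cmod_power2 sum.distrib)
  have R: "5/9 * sqrt ?R \<le> ?m"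
    using abs_Re_le_cmod[of "\<Sum>i<n. e i *\<^sub>R a i" for e]
    by (intro order_trans[OF khintchine_real] sign_avg_mono) simp
  have I: "5/9 * sqrt ?I \<le> ?m"
    using abs_Im_le_cmod[of "\<Sum>i<n. e i *\<^sub>R a i" for e]
    by (intro order_trans[OF khintchine_real] sign_avg_mono) simp
  have nn: "0 \<le> ?m" by (simp add: sign_avg_nonneg)
  have "(5/9 * sqrt ?R)\<^sup>2 \<le> ?m\<^sup>2" "(5/9 * sqrt ?I)\<^sup>2 \<le> ?m\<^sup>2"
    by (intro power_mono R I; simp add: sum_nonneg)+
  then have "25/81 * ?R \<le> ?m\<^sup>2" "25/81 * ?I \<le> ?m\<^sup>2"
    by (simp_all add: power_mult_distrib power_divide sum_nonneg)
  moreover have "0 \<le> ?s" by (simp add: sum_nonneg)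
  \<comment> \<open>Adding both bounds gives 25/162 \<open>?s\<close> \<le>
    \<open>?m\<^sup>2\<close>, and 25/162 exceeds 1/9.\<close>
  ultimately have "(1/3)\<^sup>2 * ?s \<le> ?m\<^sup>2" using s by (simp add: power_divide)
  then have "(1/3 * sqrt ?s)\<^sup>2 \<le> ?m\<^sup>2"
    by (simp only: power_mult_distrib real_sqrt_pow2[OF \<open>0 \<le> ?s\<close>])
  then show ?thesis using nn by (rule power2_le_imp_le)
qed

section \<open>Rademacher functions\<close>

text \<open>Rescaling each half of [0, 1] to full length reproduces the recursion of
  \<open>sign_avg\<close>. The hypotheses on \<open>f\<close> omit t = 1, a null set, where the
  formulas for the Rademacher functions fail.\<close>

lemma has_bochner_integral_unit_halves:
  fixes f A B :: "real \<Rightarrow> real"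
  assumes A: "has_bochner_integral unit_measure A a" and B: "has_bochner_integral unit_measure B b"
    and fA: "\<And>t. t \<in> {0..<1} \<Longrightarrow> f (t / 2) = A t"
    and fB: "\<And>t. t \<in> {0..<1} \<Longrightarrow> f ((t + 1) / 2) = B t"
  shows "has_bochner_integral unit_measure f ((a + b) / 2)"
proof -
  have unit: "has_bochner_integral unit_measure g c
      \<longleftrightarrow> has_bochner_integral lborel (\<lambda>t. indicator {0..<1} t * g t) c" for g :: "real \<Rightarrow> real" and c
  proof -
    have "has_bochner_integral unit_measure g c
        \<longleftrightarrow> has_bochner_integral lborel (\<lambda>t. indicator {0..1} t *\<^sub>R g t) c"
      by (rule has_bochner_integral_restrict_space) simp
    also have "\<dots> \<longleftrightarrow> has_bochner_integral lborel (\<lambda>t. indicator {0..<1} t * g t) c"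
      by (rule has_bochner_integral_discrete_difference[where X = "{1}"]) (auto split: split_indicator)
    finally show ?thesis .
  qed
  have "has_bochner_integral lborel (\<lambda>t. indicator {0..<1} (0 + 2 * t) * A (0 + 2 * t)) (a /\<^sub>R \<bar>2\<bar>)"
    using A unfolding unit by (subst (asm) lborel_has_bochner_integral_real_affine_iff[where c = 2 and t = 0]) auto
  moreover have "has_bochner_integral lborel (\<lambda>t. indicator {0..<1} (- 1 + 2 * t) * B (- 1 + 2 * t)) (b /\<^sub>R \<bar>2\<bar>)"
    using B unfolding unit by (subst (asm) lborel_has_bochner_integral_real_affine_iff[where c = 2 and t = "- 1"]) auto
  ultimately have "has_bochner_integral lborel
      (\<lambda>t. indicator {0..<1} (0 + 2 * t) * A (0 + 2 * t) + indicator {0..<1} (- 1 + 2 * t) * B (- 1 + 2 * t))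
      (a /\<^sub>R \<bar>2\<bar> + b /\<^sub>R \<bar>2\<bar>)"
    by (rule has_bochner_integral_add)
  moreover have "indicator {0..<1} (0 + 2 * t) * A (0 + 2 * t) + indicator {0..<1} (- 1 + 2 * t) * B (- 1 + 2 * t)
      = indicator {0..<1} t * f t" for t
    using fA[of "2 * t"] fB[of "2 * t - 1"] by (auto split: split_indicator)
  ultimately show ?thesis unfolding unit by (simp add: field_simps)
qed

lemma rademacher_0:
  assumes "t \<in> {0..<1}"
  shows "rademacher 0 (t / 2) = 1" "rademacher 0 ((t + 1) / 2) = - 1"
proof -
  have "\<lfloor>2 ^ Suc 0 * (t / 2)\<rfloor> = 0" "\<lfloor>2 ^ Suc 0 * ((t + 1) / 2)\<rfloor> = 1"
    using assms by (auto simp: floor_eq_iff)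
  then show "rademacher 0 (t / 2) = 1" "rademacher 0 ((t + 1) / 2) = - 1"
    unfolding rademacher_def by auto
qed

lemma rademacher_Suc:
  "rademacher (Suc j) (t / 2) = rademacher j t"
  "rademacher (Suc j) ((t + 1) / 2) = rademacher j t"
proof -
  have "2 ^ Suc (Suc j) * (t / 2) = 2 ^ Suc j * t" by simp
  then show "rademacher (Suc j) (t / 2) = rademacher j t"
    unfolding rademacher_def by (simp only:)
  \<comment> \<open>Moving to the right half shifts the argument of the floor by the even integer
    2^(j+1), so the parity is unchanged.\<close>
  have "2 ^ Suc (Suc j) * ((t + 1) / 2) = 2 ^ Suc j * t + of_int (2 ^ Suc j)"
    by (simp add: algebra_simps)
  then have "\<lfloor>2 ^ Suc (Suc j) * ((t + 1) / 2)\<rfloor> = \<lfloor>2 ^ Suc j * t\<rfloor> + 2 ^ Suc j"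
    by (simp only: floor_add_int)
  then have "even \<lfloor>2 ^ Suc (Suc j) * ((t + 1) / 2)\<rfloor> = even \<lfloor>2 ^ Suc j * t\<rfloor>"
    by (simp only:) simp
  then show "rademacher (Suc j) ((t + 1) / 2) = rademacher j t"
    unfolding rademacher_def by (simp only:)
qed

text \<open>The first Rademacher function is constant on each half and the others repeat there.
  Keeping \<open>G\<close> arbitrary lets the induction absorb the first term into it;
  \<open>G\<close> may be any function because the integrand is a step function off a null
  set.\<close>

lemma has_bochner_integral_rademacher:
  fixes G :: "'a::real_vector \<Rightarrow> real"
  shows "has_bochner_integral unit_measure (\<lambda>t. G (\<Sum>i<n. rademacher i t *\<^sub>R x i))
    (sign_avg n (\<lambda>e. G (\<Sum>i<n. e i *\<^sub>R x i)))"
proof (induction n arbitrary: G x)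
  case 0
  have "has_bochner_integral lborel (\<lambda>t::real. indicator {0..1} t *\<^sub>R G 0) (measure lborel {0..1::real} *\<^sub>R G 0)"
    by (rule has_bochner_integral_indicator) auto
  then show ?case by (subst has_bochner_integral_restrict_space) auto
next
  case (Suc n)
  have "has_bochner_integral unit_measure (\<lambda>t. G (\<Sum>i<Suc n. rademacher i t *\<^sub>R x i))
      ((sign_avg n (\<lambda>e. G (1 *\<^sub>R x 0 + (\<Sum>i<n. e i *\<^sub>R x (Suc i))))
       + sign_avg n (\<lambda>e. G ((-1) *\<^sub>R x 0 + (\<Sum>i<n. e i *\<^sub>R x (Suc i))))) / 2)"
    by (rule has_bochner_integral_unit_halves[OF Suc[of "\<lambda>v. G (1 *\<^sub>R x 0 + v)"] Suc[of "\<lambda>v. G ((-1) *\<^sub>R x 0 + v)"]])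
      (simp_all only: sum.lessThan_Suc_shift rademacher_0 rademacher_Suc(2),
       simp only: rademacher_Suc(1))
  then show ?case unfolding sign_avg.simps sum_case_nat by simp
qed

lemmas integral_rademacher = has_bochner_integral_integral_eq[OF has_bochner_integral_rademacher]

section \<open>A function with compactly supported Fourier transform\<close>

text \<open>The Fourier transform of \<open>bump\<close> is a multiple of a triangle function. The value of the constant
  \<open>bump_const\<close> (which is \<open>\<pi>\<close>) plays no role: only the support matters.\<close>

definition bump :: "real \<Rightarrow> real" where
  "bump s = (1 - cos (pi * s)) / s\<^sup>2"

definition bump_const :: real where
  "bump_const = (\<integral>s. (1 - cos s) / s\<^sup>2 \<partial>lborel)"

lemma one_minus_cos_le: "1 - cos s \<le> s\<^sup>2 / (2::real)"
proof -
  have "1 - cos s = 2 * (sin (s/2))\<^sup>2"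
    using cos_double_sin[of "s/2"] by simp
  also have "\<dots> \<le> 2 * (s/2)\<^sup>2"
    using abs_sin_x_le_abs_x[of "s/2"] by (simp only: abs_le_square_iff)
  finally show ?thesis by (simp add: power_divide)
qed

lemma integrable_one_minus_cos: "integrable lborel (\<lambda>s::real. (1 - cos s) / s\<^sup>2)"
proof (rule Bochner_Integration.integrable_bound)
  show "integrable lborel (\<lambda>s::real. 4 * inverse (1 + s\<^sup>2))"
    using integrable_inverse_1_plus_square by (simp add: set_integrable_def)
  show "AE s::real in lborel. norm ((1 - cos s) / s\<^sup>2) \<le> norm (4 * inverse (1 + s\<^sup>2))"
  proof (rule AE_I2)
    fix s :: real
    have nn: "0 \<le> (1 - cos s) / s\<^sup>2" by simp
    have "(1 - cos s) / s\<^sup>2 \<le> 4 / (1 + s\<^sup>2)"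
    proof (cases "s = 0")
      case False
      \<comment> \<open>Both bounds on 1 - cos s are combined: s^2/2 against the summand 1, and 2
        against the summand s^2.\<close>
      have "(1 - cos s) * (1 + s\<^sup>2) \<le> 4 * s\<^sup>2"
      proof -
        have "(1 - cos s) * s\<^sup>2 \<le> 2 * s\<^sup>2"
          using cos_ge_minus_one[of s] by (intro mult_right_mono) auto
        moreover have "0 \<le> s\<^sup>2" by simp
        ultimately show ?thesis
          using one_minus_cos_le[of s] unfolding distrib_left mult_1_right by linarith
      qed
      moreover have "0 < s\<^sup>2" "0 < 1 + s\<^sup>2" using False by (simp_all add: add_pos_nonneg)
      ultimately show ?thesis by (simp only: pos_divide_le_eq times_divide_eq_left pos_le_divide_eq)
    qed auto
    then show "norm ((1 - cos s) / s\<^sup>2) \<le> norm (4 * inverse (1 + s\<^sup>2))"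
      using nn by (simp add: divide_inverse)
  qed
qed measurable

lemma has_integral_one_minus_cos:
  "has_bochner_integral lborel (\<lambda>s::real. (1 - cos (b * s)) / s\<^sup>2) (bump_const * \<bar>b\<bar>)"
proof (cases "b = 0")
  case False
  have "has_bochner_integral lborel (\<lambda>s::real. (1 - cos s) / s\<^sup>2) bump_const"
    unfolding bump_const_def by (rule has_bochner_integral_integrable[OF integrable_one_minus_cos])
  then have "has_bochner_integral lborel (\<lambda>s::real. (1 - cos (0 + b * s)) / (0 + b * s)\<^sup>2) (bump_const /\<^sub>R \<bar>b\<bar>)"
    using False by (subst (asm) lborel_has_bochner_integral_real_affine_iff[where c = b and t = 0]) auto
  from has_bochner_integral_mult_right[OF this, of "b\<^sup>2"]
  have "has_bochner_integral lborel (\<lambda>s::real. b\<^sup>2 * ((1 - cos (0 + b * s)) / (0 + b * s)\<^sup>2)) (b\<^sup>2 * (bump_const /\<^sub>R \<bar>b\<bar>))"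
    by simp
  moreover have "b\<^sup>2 * (bump_const /\<^sub>R \<bar>b\<bar>) = bump_const * \<bar>b\<bar>"
    using False by (simp add: power2_eq_square field_simps abs_if)
  ultimately have "has_bochner_integral lborel (\<lambda>s::real. b\<^sup>2 * ((1 - cos (0 + b * s)) / (0 + b * s)\<^sup>2)) (bump_const * \<bar>b\<bar>)"
    by (simp only:)
  then show ?thesis using False by (simp add: power_mult_distrib)
qed (simp add: has_bochner_integral_iff)

text \<open>By the product-to-sum formula the integrand is a combination of three functions (1 -
  cos(cs))/s^2, each with integral proportional to |c|. The three absolute values combine into a
  triangle supported in [-\<pi>, \<pi>].\<close>

lemma has_integral_bump_cos:
  "has_bochner_integral lborel (\<lambda>s. bump s * cos (b * s)) (bump_const * max 0 (pi - \<bar>b\<bar>))"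
proof -
  have "has_bochner_integral lborel
      (\<lambda>s. (1/2) * ((1 - cos ((pi + b) * s)) / s\<^sup>2) + (1/2) * ((1 - cos ((pi - b) * s)) / s\<^sup>2) - (1 - cos (b * s)) / s\<^sup>2)
      ((1/2) * (bump_const * \<bar>pi + b\<bar>) + (1/2) * (bump_const * \<bar>pi - b\<bar>) - bump_const * \<bar>b\<bar>)"
    by (intro has_bochner_integral_diff has_bochner_integral_add has_bochner_integral_mult_right
        has_integral_one_minus_cos)
  moreover have "(1/2) * ((1 - cos ((pi + b) * s)) / s\<^sup>2) + (1/2) * ((1 - cos ((pi - b) * s)) / s\<^sup>2) - (1 - cos (b * s)) / s\<^sup>2
      = bump s * cos (b * s)" for s
  proof -
    have "(1/2) * (1 - cos ((pi + b) * s)) + (1/2) * (1 - cos ((pi - b) * s)) - (1 - cos (b * s))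
        = (1 - cos (pi * s)) * cos (b * s)"
      unfolding distrib_right left_diff_distrib cos_add cos_diff by (simp add: algebra_simps)
    then show ?thesis
      unfolding bump_def times_divide_eq_right times_divide_eq_left
      by (simp only: flip: diff_divide_distrib add_divide_distrib)
  qed
  moreover have "(1/2) * (bump_const * \<bar>pi + b\<bar>) + (1/2) * (bump_const * \<bar>pi - b\<bar>) - bump_const * \<bar>b\<bar>
      = bump_const * ((1/2) * \<bar>pi + b\<bar> + (1/2) * \<bar>pi - b\<bar> - \<bar>b\<bar>)"
    by (simp add: algebra_simps)
  moreover have "(1/2) * \<bar>pi + b\<bar> + (1/2) * \<bar>pi - b\<bar> - \<bar>b\<bar> = max 0 (pi - \<bar>b\<bar>)"
    by (auto simp: max_def abs_if add_divide_distrib diff_divide_distrib) (use pi_gt_zero in linarith)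
  ultimately show ?thesis by simp
qed

lemma bump_nonneg: "0 \<le> bump s"
  by (simp add: bump_def)

lemma bump_le: "bump s \<le> pi\<^sup>2 / 2"
  using one_minus_cos_le[of "pi * s"]
  by (cases "s = 0") (simp_all add: bump_def divide_le_eq power_mult_distrib)

lemma bump_measurable [measurable]: "bump \<in> borel_measurable borel"
  unfolding bump_def by measurable

lemma integrable_bump: "integrable lborel bump"
  using has_integral_bump_cos[of 0] by (simp add: has_bochner_integral_iff)

text \<open>The integrand is odd, so the reflection of the line shows that its integral equals its
  own negative.\<close>

lemma has_integral_bump_sin:
  "has_bochner_integral lborel (\<lambda>s. bump s * sin (b * s)) 0"
proof -
  have "integrable lborel (\<lambda>s. bump s * sin (b * s))"
    by (rule Bochner_Integration.integrable_bound[OF integrable_bump])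
      (auto simp: abs_mult intro!: mult_left_le)
  then obtain i where i: "has_bochner_integral lborel (\<lambda>s. bump s * sin (b * s)) i"
    by (auto simp: integrable.simps)
  then have "has_bochner_integral lborel (\<lambda>s. bump (0 + (-1) * s) * sin (b * (0 + (-1) * s))) (i /\<^sub>R \<bar>-1\<bar>)"
    by (subst (asm) lborel_has_bochner_integral_real_affine_iff[where c = "-1" and t = 0]) auto
  then have "has_bochner_integral lborel (\<lambda>s. - (bump s * sin (b * s))) i"
    by (simp add: bump_def)
  from has_bochner_integral_eq[OF has_bochner_integral_minus[OF i] this] have "i = 0" by simp
  with i show ?thesis by simp
qed

lemma has_integral_bump_cis:
  "has_bochner_integral lborel (\<lambda>s. complex_of_real (bump s) * cis (b * s))
    (complex_of_real (bump_const * max 0 (pi - \<bar>b\<bar>)))"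
proof -
  have "has_bochner_integral lborel
      (\<lambda>s. complex_of_real (bump s * cos (b * s)) + \<i> * complex_of_real (bump s * sin (b * s)))
      (complex_of_real (bump_const * max 0 (pi - \<bar>b\<bar>)) + \<i> * complex_of_real 0)"
    by (intro has_bochner_integral_add has_bochner_integral_mult_right has_bochner_integral_of_real
        has_integral_bump_cos has_integral_bump_sin)
  moreover have "complex_of_real (bump s * cos (b * s)) + \<i> * complex_of_real (bump s * sin (b * s))
      = complex_of_real (bump s) * cis (b * s)" for s
    by (simp add: cis_conv_exp complex_eq_iff flip: cis_conv_exp)
  ultimately show ?thesis by simp
qed

section \<open>Modulated bumps and their partial sums\<close>

definition wave :: "nat \<Rightarrow> real \<Rightarrow> complex" where
  "wave j s = complex_of_real (bump s) * cis (2 * pi * real j * s)"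

lemma wave_measurable [measurable]: "wave j \<in> borel_measurable borel"
  unfolding wave_def[abs_def]
proof (rule borel_measurable_times)
  show "(\<lambda>s. cis (2 * pi * real j * s)) \<in> borel_measurable borel"
    by (intro borel_measurable_continuous_onI continuous_intros)
qed measurable

lemma norm_wave: "norm (wave j s) = bump s"
  by (simp add: wave_def norm_mult bump_nonneg)

lemma integrable_wave: "integrable lborel (wave j)"
  by (rule Bochner_Integration.integrable_bound[OF integrable_bump])
    (auto simp: norm_wave bump_nonneg)

text \<open>A bounded integrable function has integrable powers: p - 1 factors are replaced by the
  upper bound of \<open>bump\<close>.\<close>

lemma integrable_bump_powr:
  assumes "1 \<le> p"
  shows "integrable lborel (\<lambda>s. bump s powr p)"
proof (rule Bochner_Integration.integrable_bound)
  show "integrable lborel (\<lambda>s. bump s * (pi\<^sup>2 / 2) powr (p - 1))"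
    using integrable_bump by simp
  have "bump s powr p \<le> bump s * (pi\<^sup>2 / 2) powr (p - 1)" for s
  proof (cases "bump s = 0")
    case False
    then have "bump s powr p = bump s * bump s powr (p - 1)"
      using bump_nonneg[of s] powr_mult_base[of "bump s" "p - 1"] by simp
    also have "\<dots> \<le> bump s * (pi\<^sup>2 / 2) powr (p - 1)"
      using assms bump_le[of s] bump_nonneg[of s] by (intro mult_left_mono powr_mono2) auto
    finally show ?thesis .
  qed simp
  then show "AE s in lborel. norm (bump s powr p) \<le> norm (bump s * (pi\<^sup>2 / 2) powr (p - 1))"
    by (simp add: bump_nonneg abs_mult)
qed measurable

lemma in_Lp_wave: "1 \<le> p \<Longrightarrow> in_Lp lborel p (wave j)"
  unfolding in_Lp_def norm_wave by (simp add: integrable_bump_powr)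

lemma fourier_wave:
  "fourier (wave j) \<xi> = complex_of_real (bump_const * max 0 (pi - \<bar>2 * pi * (real j - \<xi>)\<bar>))"
proof -
  have "wave j s * cis (- 2 * pi * s * \<xi>) = complex_of_real (bump s) * cis ((2 * pi * (real j - \<xi>)) * s)" for s
    unfolding wave_def mult.assoc cis_mult by (simp add: algebra_simps)
  then show ?thesis
    unfolding fourier_def using has_integral_bump_cis by (simp add: has_bochner_integral_iff)
qed

lemma fourier_wave_eq_0: "1/2 \<le> \<bar>real j - \<xi>\<bar> \<Longrightarrow> fourier (wave j) \<xi> = 0"
proof -
  assume "1/2 \<le> \<bar>real j - \<xi>\<bar>"
  then have "pi \<le> \<bar>2 * pi * (real j - \<xi>)\<bar>"
    using mult_left_mono[of "1/2" "\<bar>real j - \<xi>\<bar>" "2 * pi"] by (simp add: abs_mult)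
  then show ?thesis unfolding fourier_wave by (simp add: max_def)
qed

lemma in_Lp_fourier_wave: "in_Lp lborel 2 (fourier (wave j))"
proof -
  have m: "fourier (wave j) \<in> borel_measurable lborel"
    unfolding fourier_wave[abs_def] by measurable
  have "integrable lborel (\<lambda>\<xi>. norm (fourier (wave j) \<xi>) powr 2)"
  proof (rule Bochner_Integration.integrable_bound)
    show "integrable lborel (\<lambda>\<xi>. (bump_const * pi)\<^sup>2 * indicator {real j - 1/2..real j + 1/2} \<xi> :: real)"
      by simp
    show "(\<lambda>\<xi>. norm (fourier (wave j) \<xi>) powr 2) \<in> borel_measurable lborel" using m by measurable
    have "norm (fourier (wave j) \<xi>) powr 2 \<le> (bump_const * pi)\<^sup>2 * indicator {real j - 1/2..real j + 1/2} \<xi>" for \<xi>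
    proof (cases "\<xi> \<in> {real j - 1/2..real j + 1/2}")
      case True
      have "norm (fourier (wave j) \<xi>) \<le> \<bar>bump_const * pi\<bar>"
        unfolding fourier_wave norm_of_real abs_mult
        by (intro mult_left_mono) auto
      then have "(norm (fourier (wave j) \<xi>))\<^sup>2 \<le> (bump_const * pi)\<^sup>2"
        by (metis abs_le_square_iff abs_norm_cancel)
      then show ?thesis using True by simp
    next
      case False
      then have "1/2 \<le> \<bar>real j - \<xi>\<bar>" by (auto simp: abs_if)
      then show ?thesis by (simp add: fourier_wave_eq_0)
    qed
    then show "AE \<xi> in lborel. norm (norm (fourier (wave j) \<xi>) powr 2)
        \<le> norm ((bump_const * pi)\<^sup>2 * indicator {real j - 1/2..real j + 1/2} \<xi> :: real)"
      by (simp add: abs_mult)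
  qed
  with m show ?thesis unfolding in_Lp_def by simp
qed

lemma Lp_converges_const: "in_Lp M p f \<Longrightarrow> Lp_converges M p (\<lambda>_. f) f"
  by (simp add: Lp_converges_def Lp_norm_def)

lemma has_fourier_L2_fourier:
  assumes "integrable lborel f" "in_Lp lborel 2 f" "in_Lp lborel 2 (fourier f)"
  shows "has_fourier_L2 f (fourier f)"
  unfolding has_fourier_L2_def using assms by (intro exI[of _ "\<lambda>_. f"]) (simp add: Lp_converges_const)

lemma in_Lp_zero: "in_Lp M p (\<lambda>_. 0)"
  by (simp add: in_Lp_def)

lemma has_fourier_L2_zero: "has_fourier_L2 (\<lambda>_. 0) (\<lambda>_. 0)"
proof -
  have "fourier (\<lambda>_. 0) = (\<lambda>_. 0)" by (simp add: fourier_def fun_eq_iff)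
  then show ?thesis using has_fourier_L2_fourier[of "\<lambda>_. 0"] by (simp add: in_Lp_zero)
qed

text \<open>The transform of \<open>wave i\<close> vanishes outside the open unit interval centred
  at \<open>i\<close>, so each such interval either keeps the wave whole or annihilates it. Constant
  sequences witness both closures in the definition of the operator.\<close>

lemma partial_sum_wave:
  assumes "1 \<le> p"
  shows "partial_sum p {real j - 1/2<..<real j + 1/2} (wave i) (if i = j then wave i else (\<lambda>_. 0))"
proof -
  let ?I = "{real j - 1/2<..<real j + 1/2}"
  have f: "has_fourier_L2 (wave i) (fourier (wave i))"
    by (intro has_fourier_L2_fourier integrable_wave in_Lp_wave in_Lp_fourier_wave) simp
  have "fourier (wave i) \<xi> * indicator ?I \<xi> = (if i = j then fourier (wave i) \<xi> else 0)" for \<xi>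
  proof (cases "1/2 \<le> \<bar>real i - \<xi>\<bar>")
    case False
    then have "i = j \<longleftrightarrow> \<xi> \<in> ?I"
      by (auto simp: abs_if split: if_splits)
    then show ?thesis by auto
  qed (auto simp: fourier_wave_eq_0)
  then have "partial_sum_L2 ?I (wave i) (if i = j then wave i else (\<lambda>_. 0))"
    unfolding partial_sum_L2_def using f has_fourier_L2_zero
    by (intro exI[of _ "fourier (wave i)"]) auto
  then show ?thesis
    unfolding partial_sum_def using assms
    by (intro exI[of _ "\<lambda>_. wave i"] exI[of _ "\<lambda>_. if i = j then wave i else (\<lambda>_. 0)"])
      (simp add: Lp_converges_const in_Lp_wave in_Lp_zero)
qed

section \<open>The LPR property for trigonometric polynomials\<close>

lemma bounded_linear_scaleC_left: "bounded_linear (\<lambda>c. c *\<^sub>C (x::'a::complex_banach))"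
  by (rule bounded_linear_intro[where K = "norm x"])
    (simp_all add: scaleC_add_left norm_scaleC scaleR_scaleC scaleC_scaleC scaleC_complex_def)

lemma zero_scaleC: "0 *\<^sub>C (x::'a::complex_banach) = 0"
  using bounded_linear_scaleC_left[of x] by (rule linear_0[OF bounded_linear.linear])

text \<open>Positivity allows this integral to be cancelled from both sides of the LPR inequality.
  It follows from \<open>bump\<close> \<ge> 1 on [1/2, 1], where the cosine is nonpositive and s^2
  \<le> 1.\<close>

lemma bump_powr_integral_pos:
  assumes "1 \<le> p"
  shows "0 < (\<integral>s. bump s powr p \<partial>lborel)"
proof -
  have "indicator {1/2..1} s \<le> bump s powr p" for s
  proof (cases "s \<in> {1/2..1}")
    case True
    have "cos (pi * s) \<le> cos (pi * (1/2))"
      using True by (intro cos_monotone_0_pi_le mult_left_mono) auto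
    moreover have "s\<^sup>2 \<le> 1" using True by (simp add: power_le_one)
    ultimately have "1 \<le> bump s"
      using True by (simp add: bump_def pos_le_divide_eq)
    then show ?thesis using assms True ge_one_powr_ge_zero[of "bump s" p] by simp
  qed simp
  then have "(\<integral>s. indicator {1/2..1::real} s \<partial>lborel) \<le> (\<integral>s. bump s powr p \<partial>lborel)"
    by (intro integral_mono integrable_bump_powr assms
        integrable_real_indicator[OF _ emeasure_bounded_finite]) auto
  then show ?thesis by simp
qed

lemma LPR_trigonometric:
  assumes p: "2 \<le> p" and LPR: "LPR TYPE('a::complex_banach) p"
  obtains K where "0 \<le> K"
    "\<And>M (z :: nat \<Rightarrow> 'a) B. (\<And>s. norm (\<Sum>k<M. cis (2 * pi * real k * s) *\<^sub>C z k) \<le> B) \<Longrightarrow>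
       sign_avg M (\<lambda>e. (norm (\<Sum>k<M. e k *\<^sub>R z k))\<^sup>2) \<le> K * B\<^sup>2"
proof -
  from LPR obtain C where C: "\<forall>(J :: nat set) (I :: nat \<Rightarrow> real set) (n :: nat) \<phi> (x :: nat \<Rightarrow> 'a) \<psi>.
     finite J \<and> (\<forall>j\<in>J. is_interval (I j)) \<and> disjoint_family_on I J \<and>
     (\<forall>i<n. in_Lp lborel p (\<phi> i)) \<and> (\<forall>j\<in>J. \<forall>i<n. partial_sum p (I j) (\<phi> i) (\<psi> j i)) \<longrightarrow>
     Lp_norm lborel p (\<lambda>s. Lp_norm unit_measure p
         (\<lambda>t. \<Sum>j\<in>J. rademacher j t *\<^sub>R (\<Sum>i<n. \<psi> j i s *\<^sub>C x i)))
       \<le> C * Lp_norm lborel p (\<lambda>s. \<Sum>i<n. \<phi> i s *\<^sub>C x i)"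
    unfolding LPR_def by (elim exE) (rule that)
  have "sign_avg M (\<lambda>e. (norm (\<Sum>k<M. e k *\<^sub>R z k))\<^sup>2) \<le> 4 * C\<^sup>2 * B\<^sup>2"
    if B: "\<And>s. norm (\<Sum>k<M. cis (2 * pi * real k * s) *\<^sub>C z k) \<le> B" for M B and z :: "nat \<Rightarrow> 'a"
  proof -
    define T where "T e s = (\<Sum>k<M. e k *\<^sub>R cis (2 * pi * real k * s) *\<^sub>C z k)" for e s
    define A where "A s = sign_avg M (\<lambda>e. norm (T e s) powr p)" for s
    define Q where "Q = sign_avg M (\<lambda>e. (norm (\<Sum>k<M. e k *\<^sub>R z k))\<^sup>2)"
    define P where "P = (\<integral>s. bump s powr p \<partial>lborel)"
    have P: "0 < P" unfolding P_def using p by (intro bump_powr_integral_pos) simp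
    have Q: "0 \<le> Q" unfolding Q_def by (simp add: sign_avg_nonneg)
    have A0: "0 \<le> A s" for s unfolding A_def by (simp add: sign_avg_nonneg)
    have B0: "0 \<le> B" using B[of 0] norm_ge_zero order_trans by blast
    have wave: "wave k s *\<^sub>C z k = bump s *\<^sub>R cis (2 * pi * real k * s) *\<^sub>C z k" for k s
      by (simp add: wave_def scaleR_scaleC scaleC_scaleC)
    let ?\<psi> = "\<lambda>j i. if i = j then wave i else (\<lambda>_. 0)"
    let ?L = "\<lambda>s. Lp_norm unit_measure p
         (\<lambda>t. \<Sum>j<M. rademacher j t *\<^sub>R (\<Sum>i<M. ?\<psi> j i s *\<^sub>C z i))"
    let ?R = "Lp_norm lborel p (\<lambda>s. \<Sum>i<M. wave i s *\<^sub>C z i)"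
    have "disjoint_family_on (\<lambda>j. {real j - 1/2<..<real j + 1/2}) {..<M}"
      by (auto simp: disjoint_family_on_def)
    then have main: "Lp_norm lborel p ?L \<le> C * ?R"
      using C[rule_format, of "{..<M}" "\<lambda>j. {real j - 1/2<..<real j + 1/2}" M wave ?\<psi> z] p
      by (simp add: in_Lp_wave partial_sum_wave is_interval_oo)
    \<comment> \<open>Only the diagonal terms survive the partial sums, and \<open>bump s\<close>
      factors out of the random sum.\<close>
    have L: "norm (?L s) powr p = bump s powr p * A s" for s
    proof -
      have "(\<Sum>i<M. ?\<psi> j i s *\<^sub>C z i) = bump s *\<^sub>R cis (2 * pi * real j * s) *\<^sub>C z j" if "j < M" for j
      proof -
        have "(\<Sum>i<M. ?\<psi> j i s *\<^sub>C z i) = (\<Sum>i<M. if i = j then wave j s *\<^sub>C z j else 0)"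
          by (intro sum.cong) (auto simp: zero_scaleC)
        then show ?thesis using that by (simp add: wave)
      qed
      then have "(\<Sum>j<M. rademacher j t *\<^sub>R (\<Sum>i<M. ?\<psi> j i s *\<^sub>C z i))
          = bump s *\<^sub>R (\<Sum>j<M. rademacher j t *\<^sub>R cis (2 * pi * real j * s) *\<^sub>C z j)" for t
        by (simp add: scaleR_sum_right mult.commute)
      then have "?L s = (\<integral>t. norm (bump s *\<^sub>R (\<Sum>j<M. rademacher j t *\<^sub>R cis (2 * pi * real j * s) *\<^sub>C z j)) powr p
          \<partial>unit_measure) powr (1 / p)"
        by (simp only: Lp_norm_def)
      also have "\<dots> = sign_avg M (\<lambda>e. norm (bump s *\<^sub>R T e s) powr p) powr (1 / p)"
        unfolding integral_rademacher[where G = "\<lambda>v. norm (bump s *\<^sub>R v) powr p"] T_def ..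
      also have "\<dots> = (bump s powr p * A s) powr (1 / p)"
        by (simp add: A_def bump_nonneg powr_mult sign_avg_mult)
      finally show ?thesis using p A0[of s] by (simp add: powr_powr)
    qed
    have T_le: "norm (T e s) \<le> (\<Sum>k<M. \<bar>e k\<bar> * norm (z k))" for e s
      unfolding T_def by (intro order_trans[OF norm_sum] sum_mono) (simp add: norm_scaleC)
    have T_meas: "(\<lambda>s. norm (T e s)) \<in> borel_measurable borel" for e
      unfolding T_def
      by (intro borel_measurable_continuous_onI continuous_intros
          bounded_linear.continuous_on[OF bounded_linear_scaleC_left])
    have int_T: "integrable lborel (\<lambda>s. bump s powr p * norm (T e s) powr p)" for e
    proof (rule Bochner_Integration.integrable_bound)
      show "integrable lborel (\<lambda>s. bump s powr p * (\<Sum>k<M. \<bar>e k\<bar> * norm (z k)) powr p)"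
        using p integrable_bump_powr[of p] by simp
      show "AE s in lborel. norm (bump s powr p * norm (T e s) powr p)
          \<le> norm (bump s powr p * (\<Sum>k<M. \<bar>e k\<bar> * norm (z k)) powr p)"
        using p T_le by (auto simp: abs_mult intro!: mult_left_mono powr_mono2)
    qed (use T_meas in measurable)
    have int_A: "integrable lborel (\<lambda>s. bump s powr p * A s)"
      unfolding A_def sign_avg_mult[symmetric] by (intro sign_avg_integrable int_T)
    \<comment> \<open>Multiplying by the conjugate characters recovers the vectors
      \<open>z k\<close> at the cost of a factor 4. Jensen's inequality with exponent p/2 \<ge> 1
      then passes from squares to p-th powers, uniformly in \<open>s\<close>.\<close>
    have A_ge: "(sqrt Q / 2) powr p \<le> A s" for s
    proof -
      have "Q = sign_avg M (\<lambda>e. (norm (\<Sum>k<M. e k *\<^sub>R cis (- (2 * pi * real k * s)) *\<^sub>C cis (2 * pi * real k * s) *\<^sub>C z k))\<^sup>2)"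
        by (simp add: Q_def scaleC_scaleC cis_mult scaleC_one)
      also have "\<dots> \<le> 4 * sign_avg M (\<lambda>e. (norm (T e s))\<^sup>2)"
        unfolding T_def by (rule contraction_complex) simp
      finally have "Q / 4 \<le> sign_avg M (\<lambda>e. (norm (T e s))\<^sup>2)" by simp
      then have "(Q / 4) powr (p / 2) \<le> sign_avg M (\<lambda>e. (norm (T e s))\<^sup>2) powr (p / 2)"
        using p Q by (intro powr_mono2) auto
      also have "\<dots> \<le> sign_avg M (\<lambda>e. ((norm (T e s))\<^sup>2) powr (p / 2))"
        using p by (intro powr_sign_avg_le) auto
      finally have "(Q / 4) powr (p / 2) \<le> sign_avg M (\<lambda>e. ((norm (T e s))\<^sup>2) powr (p / 2))" .
      moreover have sq: "(x\<^sup>2) powr (p / 2) = x powr p" if "0 \<le> x" for x :: real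
        using that powr_powr[of x 2 "p / 2"] by (simp add: powr_numeral)
      moreover have "Q / 4 = (sqrt Q / 2)\<^sup>2" using Q by (simp add: power_divide)
      ultimately show ?thesis using Q by (simp add: A_def sq)
    qed
    have "(sqrt Q / 2) powr p * P \<le> (\<integral>s. bump s powr p * A s \<partial>lborel)"
    proof -
      have "(sqrt Q / 2) powr p * P = (\<integral>s. bump s powr p * (sqrt Q / 2) powr p \<partial>lborel)"
        using p integrable_bump_powr[of p] by (simp add: P_def)
      also have "\<dots> \<le> (\<integral>s. bump s powr p * A s \<partial>lborel)"
        using p integrable_bump_powr[of p] A_ge by (intro integral_mono int_A mult_left_mono) auto
      finally show ?thesis .
    qed
    then have "((sqrt Q / 2) powr p * P) powr (1 / p) \<le> (\<integral>s. norm (?L s) powr p \<partial>lborel) powr (1 / p)"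
      unfolding L using p P by (intro powr_mono2) auto
    then have lower: "sqrt Q / 2 * P powr (1 / p) \<le> Lp_norm lborel p ?L"
      using p P Q by (simp add: Lp_norm_def powr_mult powr_powr)
    have "(\<integral>s. norm (\<Sum>i<M. wave i s *\<^sub>C z i) powr p \<partial>lborel) \<le> (\<integral>s. bump s powr p * B powr p \<partial>lborel)"
    proof (rule integral_mono')
      show "integrable lborel (\<lambda>s. bump s powr p * B powr p)"
        using p integrable_bump_powr[of p] by simp
      show "norm (\<Sum>i<M. wave i s *\<^sub>C z i) powr p \<le> bump s powr p * B powr p" for s
        using p B[of s] bump_nonneg[of s] B0
        by (simp add: wave flip: scaleR_sum_right powr_mult) (intro powr_mono2 mult_left_mono; simp)
    qed simp
    then have "(\<integral>s. norm (\<Sum>i<M. wave i s *\<^sub>C z i) powr p \<partial>lborel) powr (1 / p) \<le> (P * B powr p) powr (1 / p)"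
      using p integrable_bump_powr[of p] by (intro powr_mono2) (auto simp: P_def)
    then have upper: "?R \<le> B * P powr (1 / p)"
      using p P B0 by (simp add: Lp_norm_def powr_mult powr_powr mult.commute)
    have "0 \<le> ?R" by (simp add: Lp_norm_def)
    \<comment> \<open>The sign of \<open>C\<close> is unknown, so its absolute value is used before
      inserting the upper bound for \<open>?R\<close>.\<close>
    then have "sqrt Q / 2 * P powr (1 / p) \<le> \<bar>C\<bar> * ?R"
      by (intro order_trans[OF lower] order_trans[OF main] mult_right_mono abs_ge_self)
    also have "\<dots> \<le> \<bar>C\<bar> * (B * P powr (1 / p))"
      by (intro mult_left_mono upper) simp
    finally have "sqrt Q / 2 \<le> \<bar>C\<bar> * B" using P by simp
    then have "(sqrt Q / 2)\<^sup>2 \<le> (\<bar>C\<bar> * B)\<^sup>2" using Q by (intro power_mono) auto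
    then show ?thesis using Q by (simp add: power_mult_distrib power_divide flip: Q_def)
  qed
  then show ?thesis by (intro that[of "4 * C\<^sup>2"]) auto
qed

section \<open>Fejer interpolation\<close>

lemma sum_cis_eq_0:
  assumes "N > 0" "\<not> int N dvd d"
  shows "(\<Sum>k<N. cis (2 * pi * real k * of_int d / real N)) = 0"
proof -
  let ?w = "cis (2 * pi * of_int d / real N)"
  have pow: "cis (2 * pi * real k * of_int d / real N) = ?w ^ k" for k
  proof -
    have "2 * pi * real k * of_int d / real N = real k * (2 * pi * of_int d / real N)" by simp
    then show ?thesis using Complex.DeMoivre[of "2 * pi * of_int d / real N" k] by (simp only:)
  qed
  have "?w \<noteq> 1"
  proof
    assume "?w = 1"
    then have "cos (2 * pi * of_int d / real N) = 1" by (simp add: complex_eq_iff)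
    then obtain m :: int where "2 * pi * of_int d / real N = of_int m * 2 * pi"
      unfolding cos_one_2pi_int by blast
    then have "real_of_int d = of_int (m * int N)"
      using assms(1) by (simp add: field_simps)
    then have "d = m * int N" by (simp only: of_int_eq_iff)
    with assms(2) show False by simp
  qed
  moreover have "?w ^ N = cis (2 * pi * of_int d)"
    using assms(1) by (simp add: Complex.DeMoivre)
  moreover have "cis (2 * pi * of_int d) = 1" by (simp add: cis_multiple_2pi)
  ultimately show ?thesis by (simp add: pow geometric_sum)
qed

lemma parseval_cis:
  assumes "N > 0"
  shows "(\<Sum>k<N. (cmod (\<Sum>l<N. a l * cis (- (2 * pi * real k * real l / real N))))\<^sup>2)
    = real N * (\<Sum>l<N. (cmod (a l))\<^sup>2)"
proof -
  have ortho: "(\<Sum>k<N. cis (2 * pi * real k * of_int (int m - int l) / real N))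
      = (if l = m then of_nat N else 0)" if "l < N" "m < N" for l m
  proof (cases "l = m")
    case False
    then have "\<not> int N dvd (int m - int l)"
      using that zdvd_imp_le[of "int N" "\<bar>int m - int l\<bar>"] by auto
    from sum_cis_eq_0[OF assms this] show ?thesis using False by (simp only: if_False)
  qed simp
  let ?b = "\<lambda>k l. a l * cis (- (2 * pi * real k * real l / real N))"
  have "of_real (\<Sum>k<N. (cmod (\<Sum>l<N. ?b k l))\<^sup>2) = (\<Sum>k<N. (\<Sum>l<N. ?b k l) * cnj (\<Sum>m<N. ?b k m))"
    by (simp only: of_real_sum complex_norm_square)
  also have "\<dots> = (\<Sum>k<N. \<Sum>l<N. \<Sum>m<N. a l * cnj (a m) * cis (2 * pi * real k * of_int (int m - int l) / real N))"
  proof (intro sum.cong refl)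
    fix k
    have "?b k l * cnj (?b k m) = a l * cnj (a m) * cis (2 * pi * real k * of_int (int m - int l) / real N)" for l m
    proof -
      have "cis (- (2 * pi * real k * real l / real N)) * cis (2 * pi * real k * real m / real N)
          = cis (2 * pi * real k * of_int (int m - int l) / real N)"
        by (simp add: cis_mult diff_divide_distrib right_diff_distrib)
      then show ?thesis by (simp add: cis_cnj mult_ac)
    qed
    then show "(\<Sum>l<N. ?b k l) * cnj (\<Sum>m<N. ?b k m)
        = (\<Sum>l<N. \<Sum>m<N. a l * cnj (a m) * cis (2 * pi * real k * of_int (int m - int l) / real N))"
      by (simp only: cnj_sum sum_product)
  qed
  also have "\<dots> = (\<Sum>l<N. \<Sum>k<N. \<Sum>m<N. a l * cnj (a m) * cis (2 * pi * real k * of_int (int m - int l) / real N))"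
    by (rule sum.swap)
  also have "\<dots> = (\<Sum>l<N. \<Sum>m<N. \<Sum>k<N. a l * cnj (a m) * cis (2 * pi * real k * of_int (int m - int l) / real N))"
    by (intro sum.cong refl sum.swap)
  also have "\<dots> = (\<Sum>l<N. \<Sum>m<N. if m = l then a l * cnj (a l) * of_nat N else 0)"
  proof (intro sum.cong refl)
    fix l m assume "l \<in> {..<N}" "m \<in> {..<N}"
    then show "(\<Sum>k<N. a l * cnj (a m) * cis (2 * pi * real k * of_int (int m - int l) / real N))
        = (if m = l then a l * cnj (a l) * of_nat N else 0)"
      unfolding sum_distrib_left[symmetric] by (subst ortho) auto
  qed
  also have "\<dots> = of_real (real N * (\<Sum>l<N. (cmod (a l))\<^sup>2))"
    unfolding of_real_mult of_real_sum of_real_of_nat_eq complex_norm_square by (simp add: sum_distrib_left mult_ac)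
  finally show ?thesis by (simp only: of_real_eq_iff)
qed

text \<open>The coefficients of the square of the Dirichlet kernel. Squaring instead of multiplying by the
  conjugate shifts the Fejer kernel to nonnegative frequencies.\<close>

definition fejer_coeff :: "nat \<Rightarrow> nat \<Rightarrow> real" where
  "fejer_coeff N k = real (card {a. a < N \<and> a \<le> k \<and> k < a + N})"

lemma sum_fejer_coeff:
  fixes g :: "nat \<Rightarrow> complex"
  shows "(\<Sum>a<N. \<Sum>b<N. g (a + b)) = (\<Sum>k<2*N. of_real (fejer_coeff N k) * g k)"
proof -
  have "(\<Sum>b<N. g (a + b)) = (\<Sum>k<2*N. if a \<le> k \<and> k < a + N then g k else 0)" if "a < N" for a
  proof -
    have "(\<Sum>b<N. g (a + b)) = sum g {a..<a+N}"
      by (rule sum.reindex_bij_witness[of _ "\<lambda>k. k - a" "\<lambda>b. a + b"]) auto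
    also have "\<dots> = (\<Sum>k<2*N. if a \<le> k \<and> k < a + N then g k else 0)"
      using that by (intro sum.mono_neutral_cong_left) auto
    finally show ?thesis .
  qed
  then have "(\<Sum>a<N. \<Sum>b<N. g (a + b)) = (\<Sum>a<N. \<Sum>k<2*N. if a \<le> k \<and> k < a + N then g k else 0)"
    by simp
  also have "\<dots> = (\<Sum>k<2*N. \<Sum>a<N. if a \<le> k \<and> k < a + N then g k else 0)"
    by (rule sum.swap)
  also have "\<dots> = (\<Sum>k<2*N. of_real (fejer_coeff N k) * g k)"
  proof (intro sum.cong refl)
    fix k
    have "(\<Sum>a<N. if a \<le> k \<and> k < a + N then g k else 0) = (\<Sum>a\<in>{a. a < N \<and> a \<le> k \<and> k < a + N}. g k)"
      by (rule sum.mono_neutral_cong_right) auto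
    then show "(\<Sum>a<N. if a \<le> k \<and> k < a + N then g k else 0) = of_real (fejer_coeff N k) * g k"
      by (simp add: fejer_coeff_def)
  qed
  finally show ?thesis .
qed

text \<open>The indices counted for \<open>k\<close> are those with a \<le> k and the ones counted
  for \<open>k + N\<close> are those with k < a, so together they exhaust the N indices.\<close>

lemma fejer_coeff_add: "k < N \<Longrightarrow> fejer_coeff N k + fejer_coeff N (k + N) = real N"
proof -
  assume k: "k < N"
  have "card {a. a < N \<and> a \<le> k \<and> k < a + N} + card {a. a < N \<and> a \<le> k + N \<and> k + N < a + N}
      = card ({a. a < N \<and> a \<le> k \<and> k < a + N} \<union> {a. a < N \<and> a \<le> k + N \<and> k + N < a + N})"
    by (rule card_Un_disjoint[symmetric]) auto
  also have "{a. a < N \<and> a \<le> k \<and> k < a + N} \<union> {a. a < N \<and> a \<le> k + N \<and> k + N < a + N} = {..<N}"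
    using k by auto
  finally show ?thesis unfolding fejer_coeff_def by (simp flip: of_nat_add)
qed

text \<open>Folding the two periods together pairs coefficients x and y with x + y = N, and x^2 +
  y^2 \<ge> (x + y)^2 / 2. Thus the Fejer weights lose only a constant factor in the square
  sum.\<close>

lemma fejer_coeff_square_sum:
  fixes V :: "nat \<Rightarrow> real"
  assumes V: "\<And>k. V (k + N) = V k" and nn: "\<And>k. 0 \<le> V k"
  shows "(real N)\<^sup>2 / 2 * (\<Sum>k<N. V k) \<le> (\<Sum>k<2*N. (fejer_coeff N k)\<^sup>2 * V k)"
proof -
  have "(\<Sum>k<2*N. (fejer_coeff N k)\<^sup>2 * V k)
      = (\<Sum>k<N. (fejer_coeff N k)\<^sup>2 * V k) + (\<Sum>k=N..<2*N. (fejer_coeff N k)\<^sup>2 * V k)"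
    using sum.atLeastLessThan_concat[of 0 N "2*N" "\<lambda>k. (fejer_coeff N k)\<^sup>2 * V k"]
    by (simp add: atLeast0LessThan)
  also have "(\<Sum>k=N..<2*N. (fejer_coeff N k)\<^sup>2 * V k) = (\<Sum>k<N. (fejer_coeff N (k + N))\<^sup>2 * V k)"
    using sum.shift_bounds_nat_ivl[of "\<lambda>k. (fejer_coeff N k)\<^sup>2 * V k" 0 N N]
    by (simp add: atLeast0LessThan mult_2 V)
  also have "(\<Sum>k<N. (fejer_coeff N k)\<^sup>2 * V k) + (\<Sum>k<N. (fejer_coeff N (k + N))\<^sup>2 * V k)
      = (\<Sum>k<N. ((fejer_coeff N k)\<^sup>2 + (fejer_coeff N (k + N))\<^sup>2) * V k)"
    by (simp add: sum.distrib distrib_right)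
  also have "\<dots> \<ge> (\<Sum>k<N. (real N)\<^sup>2 / 2 * V k)"
  proof (intro sum_mono mult_right_mono nn)
    fix k assume "k \<in> {..<N}"
    then have eq: "fejer_coeff N k + fejer_coeff N (k + N) = real N" by (simp add: fejer_coeff_add)
    have "(x + y)\<^sup>2 / 2 \<le> x\<^sup>2 + y\<^sup>2" for x y :: real
      using sum_squares_bound[of x y] by (simp add: power2_sum)
    from this[of "fejer_coeff N k" "fejer_coeff N (k + N)"]
    show "(real N)\<^sup>2 / 2 \<le> (fejer_coeff N k)\<^sup>2 + (fejer_coeff N (k + N))\<^sup>2" unfolding eq .
  qed
  finally show ?thesis by (simp add: sum_distrib_left)
qed

text \<open>The polynomial equals the sum of the \<open>y l\<close> with coefficients
  \<open>(?D l)\<^sup>2\<close> / N^2, where \<open>?D l\<close> is a Dirichlet kernel translated to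
  the node l/N. The moduli of these coefficients add up to 1 at every point
  \<open>s\<close>.\<close>

lemma fejer_sum_norm_le:
  fixes y :: "nat \<Rightarrow> 'a::complex_banach"
  assumes N: "N > 0" and y: "\<And>l. l < N \<Longrightarrow> norm (y l) \<le> 1"
  shows "norm (\<Sum>k<2*N. cis (2 * pi * real k * s) *\<^sub>C
      (\<Sum>l<N. (of_real (fejer_coeff N k / (real N)\<^sup>2) * cis (- (2 * pi * real k * real l / real N))) *\<^sub>C y l)) \<le> 1"
proof -
  let ?D = "\<lambda>l. \<Sum>a<N. cis (2 * pi * real a * s) * cis (- (2 * pi * real l * real a / real N))"
  have coeff: "(\<Sum>k<2*N. cis (2 * pi * real k * s) * (of_real (fejer_coeff N k / (real N)\<^sup>2)
      * cis (- (2 * pi * real k * real l / real N)))) = of_real (1 / (real N)\<^sup>2) * (?D l)\<^sup>2" for l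
  proof -
    let ?g = "\<lambda>k. cis (2 * pi * real k * s) * cis (- (2 * pi * real l * real k / real N))"
    have "?g a * ?g b = ?g (a + b)" for a b
      by (simp add: cis_mult) (simp add: algebra_simps add_divide_distrib)
    then have "(?D l)\<^sup>2 = (\<Sum>a<N. \<Sum>b<N. ?g (a + b))"
      by (simp add: power2_eq_square sum_product)
    also have "\<dots> = (\<Sum>k<2*N. of_real (fejer_coeff N k) * ?g k)"
      by (rule sum_fejer_coeff)
    finally show ?thesis by (simp add: sum_distrib_left mult_ac)
  qed
  have eq: "(\<Sum>k<2*N. cis (2 * pi * real k * s) *\<^sub>C
      (\<Sum>l<N. (of_real (fejer_coeff N k / (real N)\<^sup>2) * cis (- (2 * pi * real k * real l / real N))) *\<^sub>C y l))
    = (\<Sum>l<N. (of_real (1 / (real N)\<^sup>2) * (?D l)\<^sup>2) *\<^sub>C y l)"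
    unfolding coeff[symmetric] linear_sum[OF bounded_linear.linear[OF bounded_linear_scaleC_left]]
      linear_sum[OF linear_scaleC] scaleC_scaleC
    by (rule sum.swap)
  have "norm (\<Sum>l<N. (of_real (1 / (real N)\<^sup>2) * (?D l)\<^sup>2) *\<^sub>C y l) \<le> (\<Sum>l<N. 1 / (real N)\<^sup>2 * (cmod (?D l))\<^sup>2)"
  proof (intro order_trans[OF norm_sum] sum_mono)
    fix l assume "l \<in> {..<N}"
    then have "norm (y l) \<le> 1" using y by simp
    then have "norm ((of_real (1 / (real N)\<^sup>2) * d\<^sup>2) *\<^sub>C y l) \<le> 1 / (real N)\<^sup>2 * (cmod d)\<^sup>2" for d
      using mult_left_le[of "norm (y l)" "(cmod d)\<^sup>2 / (real N)\<^sup>2"]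
      by (simp add: norm_scaleC norm_mult norm_power norm_divide)
    then show "norm ((of_real (1 / (real N)\<^sup>2) * (?D l)\<^sup>2) *\<^sub>C y l) \<le> 1 / (real N)\<^sup>2 * (cmod (?D l))\<^sup>2" .
  qed
  also have "\<dots> = 1 / (real N)\<^sup>2 * (\<Sum>l<N. (cmod (?D l))\<^sup>2)"
    by (rule sum_distrib_left[symmetric])
  \<comment> \<open>Parseval applies with the node \<open>l\<close> as dual variable: at fixed
    \<open>s\<close>, the values \<open>?D l\<close> form the discrete Fourier transform of a
    unimodular sequence.\<close>
  also have "\<dots> = 1 / (real N)\<^sup>2 * (real N * (\<Sum>a<N. (cmod (cis (2 * pi * real a * s)))\<^sup>2))"
    by (simp only: parseval_cis[OF N])
  also have "\<dots> = 1"
    using N by (simp add: power2_eq_square)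
  finally show ?thesis unfolding eq .
qed

lemma exists_blocks:
  "\<exists>blk::nat \<Rightarrow> nat. (\<forall>l<(\<Sum>j<n. m j). blk l < n) \<and>
     (\<forall>j<n. card {l. l < (\<Sum>j<n. m j) \<and> blk l = j} = m j)"
proof (induction n)
  case (Suc n)
  let ?S = "\<Sum>j<n. m j"
  from Suc obtain blk where blk: "\<forall>l<?S. blk l < n" "\<forall>j<n. card {l. l < ?S \<and> blk l = j} = m j"
    by blast
  let ?b = "\<lambda>l. if l < ?S then blk l else n"
  have card: "card {l. l < (\<Sum>j<Suc n. m j) \<and> ?b l = j} = m j" if "j < Suc n" for j
  proof (cases "j = n")
    case True
    then have "{l. l < (\<Sum>j<Suc n. m j) \<and> ?b l = j} = {?S..<?S + m n}"
      using blk(1) by (auto split: if_splits) (meson less_irrefl not_le)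
    then show ?thesis using True by simp
  next
    case False
    then have "{l. l < (\<Sum>j<Suc n. m j) \<and> ?b l = j} = {l. l < ?S \<and> blk l = j}" by auto
    then show ?thesis using False that blk(2) by simp
  qed
  have "?b l < Suc n" for l using blk(1) by (simp add: less_Suc_eq)
  with card show ?case by (intro exI[of _ ?b] conjI allI impI)
qed simp

section \<open>Type 2\<close>

text \<open>The constant is 6^2 * 4 \<open>K\<close>: 6 comes from the lower bound on the
  coefficients \<open>E j\<close>, and 4 from passing to moduli.\<close>

lemma type_2_of_trigonometric:
  assumes K: "0 \<le> K"
    and trig: "\<And>M (z :: nat \<Rightarrow> 'a::complex_banach) B.
      (\<And>s. norm (\<Sum>k<M. cis (2 * pi * real k * s) *\<^sub>C z k) \<le> B) \<Longrightarrow>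
       sign_avg M (\<lambda>e. (norm (\<Sum>k<M. e k *\<^sub>R z k))\<^sup>2) \<le> K * B\<^sup>2"
  shows "sign_avg n (\<lambda>e. (norm (\<Sum>j<n. e j *\<^sub>R (x j :: 'a)))\<^sup>2) \<le> 144 * K * (\<Sum>j<n. (norm (x j))\<^sup>2)"
proof -
  define S where "S = (\<Sum>j<n. (norm (x j))\<^sup>2)"
  have S0: "0 \<le> S" by (simp add: S_def sum_nonneg)
  show ?thesis
  proof (cases "S = 0")
    case True
    then have "x j = 0" if "j < n" for j
      using that by (simp add: S_def sum_nonneg_eq_0_iff)
    then show ?thesis by simp
  next
    case False
    with S0 have S: "0 < S" by simp
    then have n: "0 < n" by (cases n) (simp_all add: S_def)
    \<comment> \<open>Rounding up keeps every block proportionally large enough, while the n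
      roundings add at most n in total, so N lies between n and 2n.\<close>
    define m where "m j = nat \<lceil>real n * (norm (x j))\<^sup>2 / S\<rceil>" for j
    define N where "N = (\<Sum>j<n. m j)"
    have m_ge: "real n * (norm (x j))\<^sup>2 / S \<le> real (m j)" for j
      unfolding m_def by (rule real_nat_ceiling_ge)
    have m_le: "real (m j) \<le> real n * (norm (x j))\<^sup>2 / S + 1" for j
    proof -
      have "0 \<le> real n * (norm (x j))\<^sup>2 / S" using S by simp
      then show ?thesis unfolding m_def by linarith
    qed
    have total: "(\<Sum>j<n. real n * (norm (x j))\<^sup>2 / S) = real n"
      using S by (simp add: S_def flip: sum_divide_distrib sum_distrib_left)
    have N_ge: "real n \<le> real N"
      unfolding N_def of_nat_sum using sum_mono[of "{..<n}" _ "\<lambda>j. real (m j)", OF m_ge] total by simp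
    have N_le: "real N \<le> 2 * real n"
      unfolding N_def of_nat_sum using sum_mono[of "{..<n}" "\<lambda>j. real (m j)", OF m_le] total by (simp add: sum.distrib)
    have N: "0 < N" using n N_ge by simp
    obtain blk where blk: "\<And>l. l < N \<Longrightarrow> blk l < n"
      and card_blk: "\<And>j. j < n \<Longrightarrow> card {l. l < N \<and> blk l = j} = m j"
      using exists_blocks[of m n] unfolding N_def by blast
    define u where "u j = x j /\<^sub>R norm (x j)" for j
    have u_le: "norm (u j) \<le> 1" for j
      by (cases "x j = 0") (simp_all add: u_def)
    \<comment> \<open>\<open>a j k\<close> is the coefficient of \<open>u j\<close> in the k-th
      Fejer coefficient when the nodes of block \<open>j\<close> all carry
      \<open>u j\<close>.\<close>
    define a where "a j k = of_real (fejer_coeff N k / (real N)\<^sup>2)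
      * (\<Sum>l | l < N \<and> blk l = j. cis (- (2 * pi * real k * real l / real N)))" for j k
    define E where "E j = sign_avg (2 * N) (\<lambda>r. cmod (\<Sum>k<2*N. r k *\<^sub>R a j k))" for j

    \<comment> \<open>Parseval for the indicator of block \<open>j\<close> together with
      \<open>fejer_coeff_square_sum\<close> bounds the square sum of \<open>a j k\<close> below by
      \<open>m j\<close> / (2N), hence by |x_j|^2 / (4S). Khintchine's constant 1/3 then gives the
      factor 2 * 3 = 6.\<close>
    have E_ge: "norm (x j) \<le> 6 * sqrt S * E j" if j: "j < n" for j
    proof -
      define V where "V k = (cmod (\<Sum>l | l < N \<and> blk l = j. cis (- (2 * pi * real k * real l / real N))))\<^sup>2" for k
      have "V k = (cmod (\<Sum>l<N. indicator {l. blk l = j} l * cis (- (2 * pi * real k * real l / real N))))\<^sup>2" for k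
        unfolding V_def
        by (intro arg_cong[where f = "\<lambda>w. (cmod w)\<^sup>2"] sum.mono_neutral_cong_left) auto
      then have "(\<Sum>k<N. V k) = real N * (\<Sum>l<N. (cmod (indicator {l. blk l = j} l))\<^sup>2)"
        by (simp only: parseval_cis[OF N])
      also have "(\<Sum>l<N. (cmod (indicator {l. blk l = j} l))\<^sup>2) = (\<Sum>l | l < N \<and> blk l = j. 1)"
        by (intro sum.mono_neutral_cong_right) auto
      finally have sumV: "(\<Sum>k<N. V k) = real N * real (m j)"
        using card_blk[OF j] by simp
      have "cis (- (2 * pi * real (k + N) * real l / real N)) = cis (- (2 * pi * real k * real l / real N))" for k l
      proof -
        have "- (2 * pi * real (k + N) * real l / real N) = - (2 * pi * real k * real l / real N) + 2 * pi * of_int (- int l)"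
          using N by (simp add: field_simps)
        moreover have "cis (2 * pi * of_int (- int l)) = 1"
          by (rule cis_multiple_2pi) simp
        ultimately show ?thesis by (simp only: mult_1_right flip: cis_mult)
      qed
      then have "V (k + N) = V k" for k unfolding V_def by (simp only:)
      then have "(real N)\<^sup>2 / 2 * (\<Sum>k<N. V k) \<le> (\<Sum>k<2*N. (fejer_coeff N k)\<^sup>2 * V k)"
        by (rule fejer_coeff_square_sum) (simp add: V_def)
      also have "(\<Sum>k<2*N. (fejer_coeff N k)\<^sup>2 * V k) = (real N)^4 * (\<Sum>k<2*N. (cmod (a j k))\<^sup>2)"
      proof -
        have "(real N)^4 * \<bar>c / (real N)\<^sup>2\<bar>\<^sup>2 = c\<^sup>2" for c
          using N by (simp add: power_divide flip: power_mult)
        then have "(fejer_coeff N k)\<^sup>2 * V k = (real N)^4 * (cmod (a j k))\<^sup>2" for k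
          unfolding a_def V_def norm_mult power_mult_distrib norm_of_real mult.assoc[symmetric] by simp
        then show ?thesis by (simp only: sum_distrib_left)
      qed
      finally have "real (m j) / (2 * real N) \<le> (\<Sum>k<2*N. (cmod (a j k))\<^sup>2)"
        using N unfolding sumV by (simp add: field_simps power2_eq_square power4_eq_xxxx)
      moreover have "(norm (x j) / (2 * sqrt S))\<^sup>2 \<le> real (m j) / (2 * real N)"
      proof -
        have "(norm (x j) / (2 * sqrt S))\<^sup>2 = (real n * (norm (x j))\<^sup>2 / S) / (2 * (2 * real n))"
          using n S by (simp add: power_divide power_mult_distrib)
        also have "\<dots> \<le> real (m j) / (2 * real N)"
          using m_ge[of j] N_le N n by (intro frac_le mult_left_mono) auto
        finally show ?thesis .
      qed
      ultimately have "(norm (x j) / (2 * sqrt S))\<^sup>2 \<le> (\<Sum>k<2*N. (cmod (a j k))\<^sup>2)" by linarith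
      then have "norm (x j) / (2 * sqrt S) \<le> sqrt (\<Sum>k<2*N. (cmod (a j k))\<^sup>2)"
        by (rule real_le_rsqrt)
      also have "\<dots> \<le> 3 * E j"
        using khintchine_complex[of "a j" "2 * N"] by (simp add: E_def)
      finally show ?thesis using S by (simp add: field_simps)
    qed

    \<comment> \<open>The hypothesis is applied with B = 1 to the interpolation of the node values
      \<open>e (blk l) *\<^sub>R u (blk l)\<close>, which lie in the unit ball. Regrouping nodes by
      block exposes the random coefficient of each \<open>u j\<close>.\<close>
    have avg: "sign_avg (2 * N) (\<lambda>r. (norm (\<Sum>j<n. e j *\<^sub>R (\<Sum>k<2*N. r k *\<^sub>R a j k) *\<^sub>C u j))\<^sup>2) \<le> K"
      if e: "\<And>i. \<bar>e i\<bar> \<le> 1" for e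
    proof -
      define z where "z k = (\<Sum>l<N. (of_real (fejer_coeff N k / (real N)\<^sup>2)
          * cis (- (2 * pi * real k * real l / real N))) *\<^sub>C e (blk l) *\<^sub>R u (blk l))" for k
      have "norm (e (blk l) *\<^sub>R u (blk l)) \<le> 1" for l
        using e[of "blk l"] u_le[of "blk l"] by (simp add: mult_le_one)
      then have "sign_avg (2 * N) (\<lambda>r. (norm (\<Sum>k<2*N. r k *\<^sub>R z k))\<^sup>2) \<le> K * 1\<^sup>2"
        unfolding z_def by (intro trig fejer_sum_norm_le N)
      moreover have z: "z k = (\<Sum>j<n. e j *\<^sub>R a j k *\<^sub>C u j)" for k
      proof -
        have "z k = (\<Sum>j<n. \<Sum>l | l \<in> {..<N} \<and> blk l = j. (of_real (fejer_coeff N k / (real N)\<^sup>2)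
          * cis (- (2 * pi * real k * real l / real N))) *\<^sub>C e (blk l) *\<^sub>R u (blk l))"
          unfolding z_def by (rule sum.group[symmetric]) (use blk in auto)
        also have "\<dots> = (\<Sum>j<n. \<Sum>l | l < N \<and> blk l = j. (of_real (fejer_coeff N k / (real N)\<^sup>2)
          * cis (- (2 * pi * real k * real l / real N))) *\<^sub>C e j *\<^sub>R u j)"
          by (intro sum.cong) auto
        also have "\<dots> = (\<Sum>j<n. a j k *\<^sub>C e j *\<^sub>R u j)"
          unfolding a_def sum_distrib_left linear_sum[OF bounded_linear.linear[OF bounded_linear_scaleC_left]] ..
        finally show ?thesis by (simp only: linear_scale[OF linear_scaleC])
      qed
      moreover have "(\<Sum>k<2*N. r k *\<^sub>R z k) = (\<Sum>j<n. e j *\<^sub>R (\<Sum>k<2*N. r k *\<^sub>R a j k) *\<^sub>C u j)" for r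
      proof -
        have "(\<Sum>k<2*N. r k *\<^sub>R z k) = (\<Sum>j<n. \<Sum>k<2*N. r k *\<^sub>R e j *\<^sub>R a j k *\<^sub>C u j)"
          unfolding z scaleR_sum_right by (rule sum.swap)
        also have "\<dots> = (\<Sum>j<n. e j *\<^sub>R (\<Sum>k<2*N. r k *\<^sub>R a j k) *\<^sub>C u j)"
          unfolding linear_sum[OF bounded_linear.linear[OF bounded_linear_scaleC_left]]
            linear_scale[OF bounded_linear.linear[OF bounded_linear_scaleC_left]] scaleR_sum_right
          by (intro sum.cong refl) (simp add: mult.commute)
        finally show ?thesis .
      qed
      ultimately show ?thesis by simp
    qed

    \<comment> \<open>Since \<open>E j\<close> is an average over \<open>r\<close>, Jensen moves
      that average outside the squared norm. After exchanging the averages, the phases are restored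
      for each fixed \<open>r\<close> by contraction in \<open>e\<close>, and exchanging back makes
      \<open>avg\<close> applicable.\<close>
    have "sign_avg n (\<lambda>e. (norm (\<Sum>j<n. e j *\<^sub>R E j *\<^sub>R u j))\<^sup>2)
      \<le> sign_avg n (\<lambda>e. sign_avg (2 * N) (\<lambda>r. (norm (\<Sum>j<n. e j *\<^sub>R cmod (\<Sum>k<2*N. r k *\<^sub>R a j k) *\<^sub>R u j))\<^sup>2))"
    proof (rule sign_avg_mono)
      fix e :: "nat \<Rightarrow> real"
      have "sign_avg (2 * N) (\<lambda>r. e j *\<^sub>R cmod (\<Sum>k<2*N. r k *\<^sub>R a j k) *\<^sub>R u j) = e j *\<^sub>R E j *\<^sub>R u j" for j
        unfolding E_def
        by (rule sign_avg_linear[where f = "\<lambda>c. e j *\<^sub>R c *\<^sub>R u j"]) (auto intro!: linearI simp: algebra_simps)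
      then have "(\<Sum>j<n. e j *\<^sub>R E j *\<^sub>R u j)
          = sign_avg (2 * N) (\<lambda>r. \<Sum>j<n. e j *\<^sub>R cmod (\<Sum>k<2*N. r k *\<^sub>R a j k) *\<^sub>R u j)"
        by (simp only: sign_avg_sum)
      then show "(norm (\<Sum>j<n. e j *\<^sub>R E j *\<^sub>R u j))\<^sup>2
        \<le> sign_avg (2 * N) (\<lambda>r. (norm (\<Sum>j<n. e j *\<^sub>R cmod (\<Sum>k<2*N. r k *\<^sub>R a j k) *\<^sub>R u j))\<^sup>2)"
        by (simp only: norm_sign_avg_square_le)
    qed
    also have "\<dots> = sign_avg (2 * N) (\<lambda>r. sign_avg n (\<lambda>e. (norm (\<Sum>j<n. e j *\<^sub>R cmod (\<Sum>k<2*N. r k *\<^sub>R a j k) *\<^sub>R u j))\<^sup>2))"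
      by (rule sign_avg_swap)
    also have "\<dots> \<le> sign_avg (2 * N) (\<lambda>r. 4 * sign_avg n (\<lambda>e. (norm (\<Sum>j<n. e j *\<^sub>R (\<Sum>k<2*N. r k *\<^sub>R a j k) *\<^sub>C u j))\<^sup>2))"
      by (intro sign_avg_mono contraction_modulus)
    also have "\<dots> = 4 * sign_avg n (\<lambda>e. sign_avg (2 * N) (\<lambda>r. (norm (\<Sum>j<n. e j *\<^sub>R (\<Sum>k<2*N. r k *\<^sub>R a j k) *\<^sub>C u j))\<^sup>2))"
      unfolding sign_avg_mult by (subst sign_avg_swap) (rule refl)
    also have "\<dots> \<le> 4 * sign_avg n (\<lambda>e. K)"
      by (intro mult_left_mono sign_avg_mono_bounded avg) auto
    finally have Eu: "sign_avg n (\<lambda>e. (norm (\<Sum>j<n. e j *\<^sub>R E j *\<^sub>R u j))\<^sup>2) \<le> 4 * K" by simp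

    \<comment> \<open>The factor that replaces \<open>E j\<close> by its lower bound. Setting it to
      0 from \<open>n\<close> on gives |t j| \<le> 1 for every index, as the contraction principle
      demands; if \<open>E j\<close> = 0 then x_j = 0 by \<open>E_ge\<close>, and the quotient is
      0.\<close>
    define t where "t j = (if j < n then norm (x j) / (6 * sqrt S * E j) else 0)" for j
    have E0: "0 \<le> E j" for j by (simp add: E_def sign_avg_nonneg)
    have t: "\<bar>t j\<bar> \<le> 1" for j
      using E_ge[of j] E0[of j] S by (auto simp: t_def divide_le_eq_1)
    have x: "x j = (6 * sqrt S) *\<^sub>R t j *\<^sub>R E j *\<^sub>R u j" if "j < n" for j
      using E_ge[OF that] S that by (cases "x j = 0") (auto simp: t_def u_def)
    have "sign_avg n (\<lambda>e. (norm (\<Sum>j<n. e j *\<^sub>R x j))\<^sup>2)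
      = sign_avg n (\<lambda>e. (6 * sqrt S)\<^sup>2 * (norm (\<Sum>j<n. e j *\<^sub>R t j *\<^sub>R E j *\<^sub>R u j))\<^sup>2)"
    proof (intro arg_cong[where f = "sign_avg n"] ext)
      fix e :: "nat \<Rightarrow> real"
      have "(\<Sum>j<n. e j *\<^sub>R x j) = (6 * sqrt S) *\<^sub>R (\<Sum>j<n. e j *\<^sub>R t j *\<^sub>R E j *\<^sub>R u j)"
        unfolding scaleR_sum_right by (intro sum.cong refl) (simp add: x mult_ac)
      then show "(norm (\<Sum>j<n. e j *\<^sub>R x j))\<^sup>2
          = (6 * sqrt S)\<^sup>2 * (norm (\<Sum>j<n. e j *\<^sub>R t j *\<^sub>R E j *\<^sub>R u j))\<^sup>2"
        by (simp only: norm_scaleR power_mult_distrib power2_abs)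
    qed
    also have "\<dots> = (6 * sqrt S)\<^sup>2 * sign_avg n (\<lambda>e. (norm (\<Sum>j<n. e j *\<^sub>R t j *\<^sub>R E j *\<^sub>R u j))\<^sup>2)"
      by (rule sign_avg_mult)
    also have "\<dots> \<le> (6 * sqrt S)\<^sup>2 * (4 * K)"
      by (intro mult_left_mono order_trans[OF contraction_real[OF t] Eu]) simp
    finally show ?thesis using S unfolding S_def[symmetric] by (simp add: power_mult_distrib mult_ac)
  qed
qed

theorem theorem3p19:
  assumes "\<exists>p::real. 2 \<le> p \<and> LPR TYPE('a::complex_banach) p"
  shows "type_index TYPE('a) = 2"
proof -
  from assms obtain p where p: "2 \<le> p" "LPR TYPE('a) p" by blast
  then obtain K where "0 \<le> K"
    "\<And>M (z :: nat \<Rightarrow> 'a) B. (\<And>s. norm (\<Sum>k<M. cis (2 * pi * real k * s) *\<^sub>C z k) \<le> B) \<Longrightarrow>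
       sign_avg M (\<lambda>e. (norm (\<Sum>k<M. e k *\<^sub>R z k))\<^sup>2) \<le> K * B\<^sup>2"
    by (rule LPR_trigonometric) blast
  note type_2 = type_2_of_trigonometric[OF this]
  have "rademacher_type TYPE('a) 2"
    unfolding rademacher_type_def
  proof (intro exI[of _ "144 * K"] allI)
    fix n and x :: "nat \<Rightarrow> 'a"
    show "(\<integral>t. norm (\<Sum>i<n. rademacher i t *\<^sub>R x i) powr 2 \<partial>unit_measure)
        \<le> 144 * K * (\<Sum>i<n. norm (x i) powr 2)"
      unfolding integral_rademacher[where G = "\<lambda>v. norm v powr 2"] using type_2[of n x] by simp
  qed
  \<comment> \<open>Exponent 2 belongs to the set and bounds it from above, so the supremum is
    attained there.\<close>
  then show ?thesis
    unfolding type_index_def by (intro cSup_eq_maximum) auto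
qed

end
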